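(* (Interreducibility Theorem) Let $S$ be an information set, and let $A\subseteq\Omega(S)$ be a graph model that is a natural extension (that is, for each integer $d\ge2$ a set $A_d\subseteq\Omega(S)$ of $d$-bounded $S$-graphs is given, and $A_d$ is a natural extension for every $d\ge 2$ and every $k\ge 1$). Then the simple-graph approximation problem (Problem $\mathrm{SG}$ below) and the approximation problem for $(S,A)$ (Problem $\mathrm{Ext}(S,A)$ below) are interreducible.
   Context: All graphs are finite, and have at least one vertex whenever frequency vectors are considered. Simple graphs. A simple graph is undirected, without loops or multiple edges; it is $d$-bounded if its maximum degree is at most $d$. The $k$-disc of a vertex $v$ is the subgraph induced by the vertices at distance at most $k$ from $v$, rooted at $v$; isomorphisms of $k$-discs are root-preserving graph isomorphisms. $\mathrm{freq}_k(G)$ is the vector indexed by the finitely many isomorphism types of $d$-bounded $k$-discs whose $\Gamma$-entry is the fraction of vertices of $G$ whose $k$-disc is isomorphic to $\Gamma$. $S$-graphs. An information set is a finite non-empty set $S$. An $S$-graph is a pair $G=(V,I)$ with $V$ a finite vertex set and $I:V\times V\to\{0\}\cup(\{1\}\times S)$; $\Omega(S)$ is the set of all $S$-graphs. Distinct vertices $u,v$ are joined by an edge if $I(u,v)\ne0$ or $I(v,u)\ne 0$; $I(v,v)\neq0$ is a loop. $G$ is $d$-bounded if every vertex lies on at most $d$ edges, a loop counting as two. Distance is the length of a shortest sequence of consecutive edges, ignoring direction. The $k$-disc of $v$ is the $S$-graph induced by the vertices at distance at most $k$ from $v$, rooted at $v$; isomorphisms of $k$-discs are root-preserving bijections $\phi$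 with $I_1(x,y)=I_2(\phi(x),\phi(y))$ for all $x,y$. $\mathrm{freq}_k(G)$ is the vector, indexed by isomorphism types of $d$-bounded $k$-discs, of the fractions of vertices with each type of $k$-disc. The underlying simple graph $U(G)$ has vertex set $V$ and an edge between distinct $u,v$ iff they are joined by an edge in $G$. Natural sets. Fix $d\ge2$, $k\ge1$, and let $B\subseteq\Omega(S)$ be a set of $d$-bounded $S$-graphs. $B$ is natural if for every $G_S\in B$ and every $d$-bounded $H_S\in\Omega(S)$ there is $H_S^1\in B$ with $\|\mathrm{freq}_k(G_S)-\mathrm{freq}_k(H_S^1)\|_1\le\|\mathrm{freq}_k(G_S)-\mathrm{freq}_k(H_S)\|_1$ and $|V(H_S^1)|\le|V(H_S)|$. $B$ is a natural extension if it is natural and for every $d$-bounded simple graph $G$ there is $G_S\in B$ with $U(G_S)=G$. Problem $\mathrm{SG}$ (Alon): a solution is a function $f(d,k,\epsilon)$, defined for integers $d\ge2$, $k\ge1$ and $\epsilon\in(0,1)$, with positive integer values, such that for every $d$-bounded simple graph $G$ there is a $d$-bounded simple graph $H$ with $\|\mathrm{freq}_k(G)-\mathrm{freq}_k(H)\|_1\le\epsilon$ and $|V(H)|\le f(d,k,\epsilon)$. The question is whether a computable solution exists. Problem $\mathrm{Ext}(S,A)$: a solution is a function $f_{S,A}(d,k,\epsilon)$ on the same domain such that for every $G\in A_d$ there is $H\in A_d$ with $\|\mathrm{freq}_k(G)-\mathrm{freq}_k(H)\|_1\le\epsilon$ and $|V(H)|\le f_{S,A}(d,k,\epsilon)$.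 The question is whether a computable solution exists. Interreducible: a problem $\mathcal P_2$ is reducible to a problem $\mathcal P_1$ if there is a deterministic algorithm which, using any solution of $\mathcal P_1$ as a subroutine (oracle), computes a solution of $\mathcal P_2$; two problems are interreducible if each is reducible to the other. For computability purposes $\epsilon$ ranges over rational numbers in $(0,1)$. *)

theory Defs
  imports Complex_Main "HOL-Library.Extended_Nat" "HOL-Library.Infinite_Typeclass"
begin

section \<open>Distances and frequency vectors\<close>

text \<open>
  Distance with respect to an adjacency relation: the length of a shortest walk, and
  \<open>\<infinity>\<close> (the infimum of the empty set) if there is none.
\<close>

definition walk_dist :: "('v \<times> 'v) set \<Rightarrow> 'v \<Rightarrow> 'v \<Rightarrow> enat" where
  "walk_dist R u v = (INF n \<in> {n. (u, v) \<in> R ^^ n}. enat n)"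

definition frequency :: "'v set \<Rightarrow> ('v \<Rightarrow> 'r) \<Rightarrow> 'r set \<Rightarrow> real" where
  "frequency V disc \<Gamma> = real (card {v \<in> V. disc v \<in> \<Gamma>}) / real (card V)"

text \<open>
  The index set \<open>T\<close> will always be a set of isomorphism types of \<open>k\<close>-discs of
  \<open>d\<close>-bounded graphs, of which there are only finitely many.
\<close>

definition l1_dist :: "'i set \<Rightarrow> ('i \<Rightarrow> real) \<Rightarrow> ('i \<Rightarrow> real) \<Rightarrow> real" where
  "l1_dist T x y = (\<Sum>\<Gamma>\<in>T. \<bar>x \<Gamma> - y \<Gamma>\<bar>)"


section \<open>Simple graphs\<close>

datatype 'v sgraph = SGraph (nodes: "'v set") (edges: "'v set set")

definition simple_graph :: "'v sgraph \<Rightarrow> bool" where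
  "simple_graph G \<longleftrightarrow> finite (nodes G) \<and> (\<forall>e\<in>edges G. e \<subseteq> nodes G \<and> card e = 2)"

definition simple_bounded :: "nat \<Rightarrow> 'v sgraph \<Rightarrow> bool" where
  "simple_bounded d G \<longleftrightarrow> (\<forall>v\<in>nodes G. card {e \<in> edges G. v \<in> e} \<le> d)"

definition simple_adj :: "'v sgraph \<Rightarrow> ('v \<times> 'v) set" where
  "simple_adj G = {(u, v). {u, v} \<in> edges G}"

definition simple_induced :: "'v sgraph \<Rightarrow> 'v set \<Rightarrow> 'v sgraph" where
  "simple_induced G W = SGraph W {e \<in> edges G. e \<subseteq> W}"

text \<open>Rooted graphs are pairs of a graph and its root.\<close>

definition simple_disc :: "nat \<Rightarrow> 'v sgraph \<Rightarrow> 'v \<Rightarrow> 'v sgraph \<times> 'v" where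
  "simple_disc k G v =
     (simple_induced G {u \<in> nodes G. walk_dist (simple_adj G) v u \<le> enat k}, v)"

definition simple_rooted_iso :: "'v sgraph \<times> 'v \<Rightarrow> 'v sgraph \<times> 'v \<Rightarrow> bool" where
  "simple_rooted_iso D1 D2 \<longleftrightarrow>
     (\<exists>\<phi>. bij_betw \<phi> (nodes (fst D1)) (nodes (fst D2)) \<and> \<phi> (snd D1) = snd D2 \<and>
        (\<forall>x\<in>nodes (fst D1). \<forall>y\<in>nodes (fst D1).
           {x, y} \<in> edges (fst D1) \<longleftrightarrow> {\<phi> x, \<phi> y} \<in> edges (fst D2)))"

definition simple_discs :: "nat \<Rightarrow> nat \<Rightarrow> ('v sgraph \<times> 'v) set" where
  "simple_discs d k =
     {simple_disc k G v | G v. simple_graph G \<and> simple_bounded d G \<and> v \<in> nodes G}"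

definition simple_disc_types :: "nat \<Rightarrow> nat \<Rightarrow> ('v sgraph \<times> 'v) set set" where
  "simple_disc_types d k =
     simple_discs d k //
       {(D1, D2). D1 \<in> simple_discs d k \<and> D2 \<in> simple_discs d k \<and> simple_rooted_iso D1 D2}"

definition simple_freq :: "nat \<Rightarrow> 'v sgraph \<Rightarrow> ('v sgraph \<times> 'v) set \<Rightarrow> real" where
  "simple_freq k G = frequency (nodes G) (simple_disc k G)"

definition simple_freq_dist :: "nat \<Rightarrow> nat \<Rightarrow> 'v sgraph \<Rightarrow> 'v sgraph \<Rightarrow> real" where
  "simple_freq_dist d k G H =
     l1_dist (simple_disc_types d k) (simple_freq k G) (simple_freq k H)"


section \<open>Graphs with an information set\<close>

text \<open>
  The value set $\{0\} \cup (\{1\} \times S)$ is modelled by options: \<open>None\<close> is $0$ and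
  \<open>Some s\<close> is $(1, s)$.  Since HOL functions are total, the information function is
  required to be \<open>None\<close> off $V \times V$; hence equal graphs are equal as HOL values.
\<close>

datatype ('v, 's) igraph = IGraph (verts: "'v set") (info: "'v \<times> 'v \<Rightarrow> 's option")

definition Omega :: "'s set \<Rightarrow> ('v, 's) igraph set" where
  "Omega S = {G. finite (verts G) \<and>
     (\<forall>u\<in>verts G. \<forall>v\<in>verts G. info G (u, v) \<in> {None} \<union> Some ` S) \<and>
     (\<forall>u v. u \<notin> verts G \<or> v \<notin> verts G \<longrightarrow> info G (u, v) = None)}"

definition info_adj :: "('v, 's) igraph \<Rightarrow> ('v \<times> 'v) set" where
  "info_adj G = {(u, v). u \<noteq> v \<and> (info G (u, v) \<noteq> None \<or> info G (v, u) \<noteq> None)}"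

definition info_bounded :: "nat \<Rightarrow> ('v, 's) igraph \<Rightarrow> bool" where
  "info_bounded d G \<longleftrightarrow> (\<forall>v\<in>verts G.
     card {u \<in> verts G. (v, u) \<in> info_adj G} + (if info G (v, v) \<noteq> None then 2 else 0) \<le> d)"

definition info_induced :: "('v, 's) igraph \<Rightarrow> 'v set \<Rightarrow> ('v, 's) igraph" where
  "info_induced G W =
     IGraph W (\<lambda>(u, v). if u \<in> W \<and> v \<in> W then info G (u, v) else None)"

definition info_disc :: "nat \<Rightarrow> ('v, 's) igraph \<Rightarrow> 'v \<Rightarrow> ('v, 's) igraph \<times> 'v" where
  "info_disc k G v =
     (info_induced G {u \<in> verts G. walk_dist (info_adj G) v u \<le> enat k}, v)"

definition info_rooted_iso ::
    "('v, 's) igraph \<times> 'v \<Rightarrow> ('v, 's) igraph \<times> 'v \<Rightarrow> bool" where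
  "info_rooted_iso D1 D2 \<longleftrightarrow>
     (\<exists>\<phi>. bij_betw \<phi> (verts (fst D1)) (verts (fst D2)) \<and> \<phi> (snd D1) = snd D2 \<and>
        (\<forall>x\<in>verts (fst D1). \<forall>y\<in>verts (fst D1).
           info (fst D1) (x, y) = info (fst D2) (\<phi> x, \<phi> y)))"

definition info_discs :: "'s set \<Rightarrow> nat \<Rightarrow> nat \<Rightarrow> (('v, 's) igraph \<times> 'v) set" where
  "info_discs S d k =
     {info_disc k G v | G v. G \<in> Omega S \<and> info_bounded d G \<and> v \<in> verts G}"

definition info_disc_types ::
    "'s set \<Rightarrow> nat \<Rightarrow> nat \<Rightarrow> (('v, 's) igraph \<times> 'v) set set" where
  "info_disc_types S d k =
     info_discs S d k //
       {(D1, D2). D1 \<in> info_discs S d k \<and> D2 \<in> info_discs S d k \<and> info_rooted_iso D1 D2}"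

definition info_freq ::
    "nat \<Rightarrow> ('v, 's) igraph \<Rightarrow> (('v, 's) igraph \<times> 'v) set \<Rightarrow> real" where
  "info_freq k G = frequency (verts G) (info_disc k G)"

definition info_freq_dist ::
    "'s set \<Rightarrow> nat \<Rightarrow> nat \<Rightarrow> ('v, 's) igraph \<Rightarrow> ('v, 's) igraph \<Rightarrow> real" where
  "info_freq_dist S d k G H =
     l1_dist (info_disc_types S d k) (info_freq k G) (info_freq k H)"

definition underlying :: "('v, 's) igraph \<Rightarrow> 'v sgraph" where
  "underlying G =
     SGraph (verts G) {{u, v} | u v. u \<in> verts G \<and> v \<in> verts G \<and> (u, v) \<in> info_adj G}"


section \<open>Natural sets and natural extensions\<close>

text \<open>Wherever frequency vectors are involved, only non-empty graphs are considered.\<close>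

definition natural :: "'s set \<Rightarrow> nat \<Rightarrow> nat \<Rightarrow> ('v, 's) igraph set \<Rightarrow> bool" where
  "natural S d k B \<longleftrightarrow>
     B \<subseteq> {G \<in> Omega S. info_bounded d G} \<and>
     (\<forall>G\<in>B. verts G \<noteq> {} \<longrightarrow>
        (\<forall>H\<in>Omega S. info_bounded d H \<and> verts H \<noteq> {} \<longrightarrow>
           (\<exists>H1\<in>B. verts H1 \<noteq> {} \<and>
              info_freq_dist S d k G H1 \<le> info_freq_dist S d k G H \<and>
              card (verts H1) \<le> card (verts H))))"

definition natural_extension :: "'s set \<Rightarrow> nat \<Rightarrow> nat \<Rightarrow> ('v, 's) igraph set \<Rightarrow> bool" where
  "natural_extension S d k B \<longleftrightarrow>
     natural S d k B \<and>
     (\<forall>G. simple_graph G \<and> simple_bounded d G \<and> nodes G \<noteq> {} \<longrightarrow>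
        (\<exists>GS\<in>B. underlying GS = G))"


section \<open>The two approximation problems\<close>

text \<open>
  A problem is identified with the set of its solutions.  Solutions are functions of
  \<open>(d, k, \<epsilon>)\<close> whose values matter only on the following domain.
\<close>

type_synonym problem = "(nat \<Rightarrow> nat \<Rightarrow> rat \<Rightarrow> nat) set"

definition in_domain :: "nat \<Rightarrow> nat \<Rightarrow> rat \<Rightarrow> bool" where
  "in_domain d k \<epsilon> \<longleftrightarrow> d \<ge> 2 \<and> k \<ge> 1 \<and> 0 < \<epsilon> \<and> \<epsilon> < 1"

text \<open>The type argument fixes the universe from which vertices are taken.\<close>

definition SG :: "'v itself \<Rightarrow> problem" where
  "SG _ = {f. \<forall>d k \<epsilon>. in_domain d k \<epsilon> \<longrightarrow> f d k \<epsilon> > 0 \<and>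
     (\<forall>G::'v sgraph. simple_graph G \<and> simple_bounded d G \<and> nodes G \<noteq> {} \<longrightarrow>
        (\<exists>H::'v sgraph. simple_graph H \<and> simple_bounded d H \<and> nodes H \<noteq> {} \<and>
           simple_freq_dist d k G H \<le> of_rat \<epsilon> \<and> card (nodes H) \<le> f d k \<epsilon>))}"

definition Ext :: "'s set \<Rightarrow> (nat \<Rightarrow> ('v, 's) igraph set) \<Rightarrow> problem" where
  "Ext S A = {f. \<forall>d k \<epsilon>. in_domain d k \<epsilon> \<longrightarrow> f d k \<epsilon> > 0 \<and>
     (\<forall>G\<in>A d. verts G \<noteq> {} \<longrightarrow>
        (\<exists>H\<in>A d. verts H \<noteq> {} \<and>
           info_freq_dist S d k G H \<le> of_rat \<epsilon> \<and> card (verts H) \<le> f d k \<epsilon>))}"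


section \<open>Oracle computability and reducibility\<close>

text \<open>
  Algorithms are programs for partial \<open>\<mu>\<close>-recursive functions with an additional basic
  instruction that queries a partial oracle on the current argument list; a query at
  which the oracle is undefined does not terminate.
\<close>

datatype prog =
    Zero
  | Succ
  | Proj nat
  | Query
  | Comp prog "prog list"
  | PrimRec prog prog
  | Mu prog

inductive computes :: "(nat list \<Rightarrow> nat option) \<Rightarrow> prog \<Rightarrow> nat list \<Rightarrow> nat \<Rightarrow> bool"
  for orac :: "nat list \<Rightarrow> nat option" where
  zero: "computes orac Zero xs 0"
| succ: "computes orac Succ (x # xs) (Suc x)"
| proj: "i < length xs \<Longrightarrow> computes orac (Proj i) xs (xs ! i)"
| query: "orac xs = Some y \<Longrightarrow> computes orac Query xs y"
| comp: "list_all2 (\<lambda>g y. computes orac g xs y) gs ys \<Longrightarrow> computes orac f ys z \<Longrightarrow>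
    computes orac (Comp f gs) xs z"
| primrec_0: "computes orac f xs y \<Longrightarrow> computes orac (PrimRec f g) (0 # xs) y"
| primrec_Suc: "computes orac (PrimRec f g) (n # xs) y \<Longrightarrow> computes orac g (n # y # xs) z \<Longrightarrow>
    computes orac (PrimRec f g) (Suc n # xs) z"
| mu: "computes orac f (n # xs) 0 \<Longrightarrow> (\<forall>m<n. \<exists>y. computes orac f (m # xs) (Suc y)) \<Longrightarrow>
    computes orac (Mu f) xs n"

lemma computes_deterministic:
  assumes "computes orac p xs y" and "computes orac p xs z"
  shows "y = z"
  using assms
proof (induction arbitrary: z rule: computes.induct)
  case (comp xs gs ys f y)
  from comp.prems obtain ys' where
    ys': "list_all2 (\<lambda>g y. computes orac g xs y) gs ys'" "computes orac f ys' z"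
    by (cases rule: computes.cases) auto
  have "ys = ys'" using comp.IH(1) ys'(1)
    by (auto simp: list_all2_conv_all_nth intro!: nth_equalityI)
  then show ?case using comp.IH(2) ys'(2) by simp
next
  case (mu f n xs)
  from mu.prems show ?case
  proof (cases rule: computes.cases)
    case mu': mu
    have "\<not> z < n" using mu.IH mu'(1) by fastforce
    moreover have "\<not> n < z" using mu.IH(1) mu'(2) by fastforce
    ultimately show ?thesis by simp
  qed
next
  case (primrec_Suc f g n xs y w)
  from primrec_Suc.prems show ?case
  proof (cases rule: computes.cases)
    case primrec_Suc': (primrec_Suc y')
    then have "y = y'" using primrec_Suc.IH(1) by simp
    then show ?thesis using primrec_Suc.IH(2) primrec_Suc'(2) by simp
  qed
next
  case (zero xs)
  then show ?case by (cases rule: computes.cases) auto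
next
  case (succ x xs)
  then show ?case by (cases rule: computes.cases) auto
next
  case (proj i xs)
  from proj.prems show ?case by (cases rule: computes.cases) auto
next
  case (query xs y)
  from query.prems query.hyps show ?case by (cases rule: computes.cases) auto
next
  case (primrec_0 f xs y g)
  from primrec_0.prems show ?case
    by (cases rule: computes.cases) (simp add: primrec_0.IH)
qed

text \<open>
  A rational \<open>\<epsilon>\<close> in \<open>(0, 1)\<close> is presented by any pair of naturals \<open>p\<close>, \<open>q\<close> with
  \<open>\<epsilon> = p / q\<close>, both in oracle queries and in the input of an algorithm.  The oracle
  for \<open>f\<close> answers on the domain of \<open>f\<close> only.
\<close>

definition fraction :: "nat \<Rightarrow> nat \<Rightarrow> rat" where
  "fraction p q = of_nat p / of_nat q"

definition oracle_of :: "(nat \<Rightarrow> nat \<Rightarrow> rat \<Rightarrow> nat) \<Rightarrow> nat list \<Rightarrow> nat option" where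
  "oracle_of f xs =
     (case xs of
        [d, k, p, q] \<Rightarrow> if q > 0 \<and> in_domain d k (fraction p q) then Some (f d k (fraction p q)) else None
      | _ \<Rightarrow> None)"

text \<open>The program must not depend on the solution that is supplied as oracle.\<close>

definition reducible :: "problem \<Rightarrow> problem \<Rightarrow> bool" where
  "reducible P2 P1 \<longleftrightarrow>
     (\<exists>alg. \<forall>f\<in>P1. \<exists>g\<in>P2. \<forall>d k p q. q > 0 \<and> in_domain d k (fraction p q) \<longrightarrow>
        computes (oracle_of f) alg [d, k, p, q] (g d k (fraction p q)))"

definition interreducible :: "problem \<Rightarrow> problem \<Rightarrow> bool" where
  "interreducible P1 P2 \<longleftrightarrow> reducible P1 P2 \<and> reducible P2 P1"

end

theory Submission
  imports Defs
begin

text \<open>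
  Both reductions rest on one observation.  Suppose that a graph \<open>F\<close> is derived from a graph
  \<open>H\<close> in such a way that the \<open>K\<close>-disc of a vertex in \<open>H\<close> decides, up to isomorphism, whether
  the vertex survives in \<open>F\<close> and what its \<open>k\<close>-disc in \<open>F\<close> is.  Then, before normalisation, the
  frequencies of \<open>F\<close> are sums of frequencies of \<open>H\<close> over disjoint sets of types, so their
  \<open>\<ell>\<^sub>1\<close> distances cannot grow; normalising by the proportion \<open>\<mu>\<close> of surviving vertices costs a
  factor of at most \<open>2 / \<mu>\<close>, and nothing if all vertices survive
  (\<open>l1_dist_frequency_transfer\<close>).

  From \<open>S\<close>-graphs to simple graphs: passing to the underlying simple graph is such a
  derivation with \<open>K = k\<close> which keeps all vertices (\<open>underlying_freq_dist_le\<close>).  Hence every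
  solution of the problem for \<open>(S, A)\<close> is already a solution for simple graphs, and the
  algorithm is a single query.

  From simple graphs to \<open>S\<close>-graphs: an \<open>S\<close>-graph \<open>G\<close> is encoded as a simple graph \<open>E\<close>, this is
  approximated by a small simple graph \<open>H\<close>, and \<open>H\<close> is decoded to an \<open>S\<close>-graph \<open>F\<close>.
  In the encoding a vertex \<open>u\<close> becomes a cluster consisting of a centre, an in-port and one
  out-port for each \<open>s \<in> S\<close>, the ports being joined to the centre.  An arc from \<open>u\<close> to \<open>w\<close>
  with label \<open>s\<close>, possibly a loop, becomes an edge from the \<open>s\<close>-out-port of \<open>u\<close> to the in-port
  of \<open>w\<close>.  With \<open>b = d + |S| + 2\<close>, every vertex of a cluster still has degree at most \<open>b\<close>, so
  pendant leaves can be added until centres have degree \<open>b\<close>, in-ports \<open>b + 1\<close>, and the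
  out-ports of different labels different larger degrees: the role of a vertex is visible in
  its degree.  Decoding makes sense for every simple graph.  The vertices of degree \<open>b\<close>
  are kept, labels are read off the paths of length three between them, pairs with no label
  or with conflicting labels are not joined, and finally a vertex of degree larger than \<open>d\<close>
  loses all its edges.  This recovers \<open>G\<close> from \<open>E\<close> (\<open>exists_encoding\<close>), always gives a
  \<open>d\<close>-bounded graph, and is local with \<open>K = 3 * k + 10\<close> (\<open>decode_disc_iso\<close>).  As the centres
  make up at least a fraction \<open>1 / C\<close> of the vertices of \<open>E\<close>, for an explicit \<open>C\<close>, it suffices
  to approximate \<open>E\<close> within \<open>\<epsilon> / (2 * C)\<close> (\<open>approximation_by_decoding\<close>).  The graph \<open>F\<close> need
  not belong to \<open>A d\<close>, but naturality of \<open>A d\<close> replaces it by a graph that does, which is no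
  larger and no further away from \<open>G\<close>.  All parameters of the query are polynomials in the
  input, hence computable.
\<close>

section \<open>Balls\<close>

text \<open>
  The recursive form makes induction on the radius immediate; \<open>walk_dist_le_iff\<close> relates it
  to distances.
\<close>

primrec ball :: "('v \<times> 'v) set \<Rightarrow> 'v \<Rightarrow> nat \<Rightarrow> 'v set" where
  "ball R x 0 = {x}"
| "ball R x (Suc k) = ball R x k \<union> R `` ball R x k"

lemma ball_eq_relpow: "ball R x k = {y. \<exists>n\<le>k. (x, y) \<in> R ^^ n}"
proof (induction k)
  case (Suc k)
  show ?case
  proof (intro set_eqI iffI)
    fix y assume "y \<in> ball R x (Suc k)"
    then show "y \<in> {y. \<exists>n\<le>Suc k. (x, y) \<in> R ^^ n}"
    proof -
      consider "y \<in> ball R x k" | z where "z \<in> ball R x k" "(z, y) \<in> R"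
        using \<open>y \<in> ball R x (Suc k)\<close> by auto
      then show ?thesis
      proof cases
        case 1
        then show ?thesis using Suc by (auto intro: le_SucI)
      next
        case 2
        then obtain n where "n \<le> k" "(x, z) \<in> R ^^ n" using Suc by auto
        then show ?thesis using 2(2) by (auto intro!: exI[of _ "Suc n"])
      qed
    qed
  next
    fix y assume "y \<in> {y. \<exists>n\<le>Suc k. (x, y) \<in> R ^^ n}"
    then obtain n where n: "n \<le> Suc k" "(x, y) \<in> R ^^ n" by auto
    show "y \<in> ball R x (Suc k)"
    proof (cases n)
      case 0
      then show ?thesis using n Suc by auto
    next
      case (Suc m)
      then obtain z where "(x, z) \<in> R ^^ m" "(z, y) \<in> R" using n by auto
      then show ?thesis using Suc.IH n Suc by auto
    qed
  qed
qed auto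

lemma walk_dist_le_iff: "walk_dist R x y \<le> enat k \<longleftrightarrow> y \<in> ball R x k"
proof -
  have "walk_dist R x y \<le> enat k \<longleftrightarrow> walk_dist R x y < enat (Suc k)"
    by (cases "walk_dist R x y") auto
  also have "\<dots> \<longleftrightarrow> (\<exists>n. (x, y) \<in> R ^^ n \<and> n < Suc k)"
    unfolding walk_dist_def by (subst INF_less_iff) auto
  also have "\<dots> \<longleftrightarrow> y \<in> ball R x k"
    by (auto simp: ball_eq_relpow less_Suc_eq_le)
  finally show ?thesis .
qed

lemma center_in_ball: "x \<in> ball R x k"
  by (induction k) auto

lemma ball_mono: "i \<le> j \<Longrightarrow> ball R x i \<subseteq> ball R x j"
  by (induction j) (auto simp: le_Suc_eq)

lemma ball_step: "y \<in> ball R x i \<Longrightarrow> (y, z) \<in> R \<Longrightarrow> Suc i \<le> j \<Longrightarrow> z \<in> ball R x j"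
  using ball_mono[of "Suc i" j R x] by auto

lemma ball_subset: "x \<in> W \<Longrightarrow> R \<subseteq> W \<times> W \<Longrightarrow> ball R x k \<subseteq> W"
  by (induction k) auto

lemma card_ball_le:
  assumes "x \<in> W" "R \<subseteq> W \<times> W" "finite W" "\<And>y. y \<in> W \<Longrightarrow> card (R `` {y}) \<le> d"
  shows "card (ball R x k) \<le> Suc d ^ k"
proof (induction k)
  case (Suc k)
  let ?B = "ball R x k"
  have sub: "?B \<subseteq> W" using ball_subset assms by metis
  then have fin: "finite ?B" using assms(3) finite_subset by blast
  have "card (R `` ?B) = card (\<Union>y\<in>?B. R `` {y})" by (rule arg_cong[of _ _ card]) auto
  also have "\<dots> \<le> (\<Sum>y\<in>?B. card (R `` {y}))" using fin by (rule card_UN_le)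
  also have "\<dots> \<le> (\<Sum>y\<in>?B. d)" using assms(4) sub by (intro sum_mono) auto
  finally have "card (R `` ?B) \<le> card ?B * d" by simp
  then have "card (ball R x (Suc k)) \<le> card ?B + card ?B * d"
    using card_Un_le[of ?B "R `` ?B"] by simp
  also have "\<dots> = card ?B * Suc d" by simp
  also have "\<dots> \<le> Suc d ^ k * Suc d" using Suc by (rule mult_le_mono1)
  finally show ?case by (simp add: mult.commute)
qed simp

text \<open>
  To see that a map sends balls to balls it is enough that it sends the neighbours of each
  inner vertex onto the neighbours of its image.  All locality proofs below reduce to this.
\<close>

lemma image_ball:
  assumes "\<And>i y. i < k \<Longrightarrow> y \<in> ball R x i \<Longrightarrow> R' `` {\<phi> y} = \<phi> ` (R `` {y})"
  shows "\<phi> ` ball R x k = ball R' (\<phi> x) k"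
  using assms
proof (induction k)
  case (Suc k)
  have "\<phi> ` (R `` ball R x k) = (\<Union>y\<in>ball R x k. \<phi> ` (R `` {y}))" by blast
  also have "\<dots> = (\<Union>y\<in>ball R x k. R' `` {\<phi> y})" using Suc.prems by (intro SUP_cong) auto
  also have "\<dots> = R' `` (\<phi> ` ball R x k)" by blast
  moreover have "\<phi> ` ball R x k = ball R' (\<phi> x) k" by (rule Suc.IH) (rule Suc.prems, auto)
  ultimately show ?case by (simp add: image_Un)
qed simp


section \<open>Isomorphisms of rooted labelled structures\<close>

text \<open>
  A common form of both kinds of rooted graphs: a vertex set \<open>W\<close>, a label \<open>l x y\<close> for each
  pair of vertices (the truth value of adjacency, or the information), and a root.
\<close>

definition rooted_iso_map where
  "rooted_iso_map \<phi> W l r W' l' r' \<longleftrightarrow> bij_betw \<phi> W W' \<and> \<phi> r = r' \<and>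
     (\<forall>x\<in>W. \<forall>y\<in>W. l x y = l' (\<phi> x) (\<phi> y))"

definition rooted_iso where
  "rooted_iso W l r W' l' r' \<longleftrightarrow> (\<exists>\<phi>. rooted_iso_map \<phi> W l r W' l' r')"

lemma rooted_iso_refl: "rooted_iso W l r W l r"
  unfolding rooted_iso_def rooted_iso_map_def by (rule exI[of _ id]) auto

lemma rooted_iso_sym:
  assumes "rooted_iso W l r W' l' r'" "r \<in> W"
  shows "rooted_iso W' l' r' W l r"
proof -
  from assms obtain \<phi> where \<phi>: "bij_betw \<phi> W W'" "\<phi> r = r'"
    and l: "\<And>x y. x \<in> W \<Longrightarrow> y \<in> W \<Longrightarrow> l x y = l' (\<phi> x) (\<phi> y)"
    unfolding rooted_iso_def rooted_iso_map_def by auto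
  have inv: "bij_betw (inv_into W \<phi>) W' W" using \<phi>(1) by (rule bij_betw_inv_into)
  moreover have "inv_into W \<phi> r' = r" using \<phi> assms(2) by (metis bij_betw_inv_into_left)
  moreover have "l' x y = l (inv_into W \<phi> x) (inv_into W \<phi> y)" if "x \<in> W'" "y \<in> W'" for x y
    using that l[of "inv_into W \<phi> x" "inv_into W \<phi> y"] inv \<phi>(1)
    by (simp add: bij_betw_inv_into_right bij_betw_apply)
  ultimately show ?thesis unfolding rooted_iso_def rooted_iso_map_def by blast
qed

lemma rooted_iso_trans:
  assumes "rooted_iso W l r W' l' r'" "rooted_iso W' l' r' W'' l'' r''"
  shows "rooted_iso W l r W'' l'' r''"
proof -
  from assms obtain \<phi> \<psi> where "rooted_iso_map \<phi> W l r W' l' r'" "rooted_iso_map \<psi> W' l' r' W'' l'' r''"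
    unfolding rooted_iso_def by auto
  then have "rooted_iso_map (\<psi> \<circ> \<phi>) W l r W'' l'' r''"
    unfolding rooted_iso_map_def by (auto intro: bij_betw_trans simp: bij_betw_apply)
  then show ?thesis unfolding rooted_iso_def by blast
qed

lemma finite_quotient_if_code:
  assumes "finite (c ` X)" "equiv X E" "\<And>x y. x \<in> X \<Longrightarrow> y \<in> X \<Longrightarrow> c x = c y \<Longrightarrow> (x, y) \<in> E"
  shows "finite (X // E)"
proof -
  have "E `` {x} = E `` {SOME y. y \<in> X \<and> c y = c x}" if "x \<in> X" for x
  proof -
    have "(SOME y. y \<in> X \<and> c y = c x) \<in> X \<and> c (SOME y. y \<in> X \<and> c y = c x) = c x"
      using that by (metis (mono_tags, lifting) someI)
    then show ?thesis using assms(3)[of x "SOME y. y \<in> X \<and> c y = c x"] that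
      by (metis assms(2) equiv_class_eq)
  qed
  then have "X // E \<subseteq> (\<lambda>z. E `` {SOME y. y \<in> X \<and> c y = z}) ` (c ` X)"
    unfolding quotient_def by blast
  then show ?thesis using assms(1) finite_surj by blast
qed

text \<open>
  Structures with at most \<open>N\<close> vertices can be copied onto an initial segment of the naturals,
  and the copy is one of finitely many; structures with the same copy are isomorphic.
\<close>

lemma finite_rooted_iso_types:
  fixes W :: "'r \<Rightarrow> 'v set" and l :: "'r \<Rightarrow> 'v \<Rightarrow> 'v \<Rightarrow> 'l" and r :: "'r \<Rightarrow> 'v"
  assumes equiv: "equiv X {(x, y). x \<in> X \<and> y \<in> X \<and> isom x y}"
    and isom: "\<And>x y. isom x y \<longleftrightarrow> rooted_iso (W x) (l x) (r x) (W y) (l y) (r y)"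
    and W: "\<And>x. x \<in> X \<Longrightarrow> finite (W x)" "\<And>x. x \<in> X \<Longrightarrow> card (W x) \<le> N"
    and r: "\<And>x. x \<in> X \<Longrightarrow> r x \<in> W x"
    and L: "finite L" "\<And>x u v. x \<in> X \<Longrightarrow> u \<in> W x \<Longrightarrow> v \<in> W x \<Longrightarrow> l x u v \<in> L"
  shows "finite (X // {(x, y). x \<in> X \<and> y \<in> X \<and> isom x y})"
proof -
  define h where "h x = (SOME h. bij_betw h (W x) {..<card (W x)})" for x
  have h: "bij_betw (h x) (W x) {..<card (W x)}" if "x \<in> X" for x
  proof -
    have "\<exists>h. bij_betw h (W x) {..<card (W x)}"
      using ex_bij_betw_finite_nat[OF W(1)[OF that]] by (simp add: lessThan_atLeast0)
    then show ?thesis unfolding h_def by (rule someI_ex)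
  qed
  \<comment> \<open>The code of a structure: its size, the number of its root, and the graph of its labelling.\<close>
  define c where "c x = (card (W x), h x (r x), (\<lambda>(u, v). (h x u, h x v, l x u v)) ` (W x \<times> W x))" for x
  have hN: "h x u < N" if "x \<in> X" "u \<in> W x" for x u
    using bij_betw_apply[OF h[OF that(1)] that(2)] W(2)[OF that(1)] by simp
  have "c ` X \<subseteq> {..N} \<times> {..<N} \<times> Pow ({..<N} \<times> {..<N} \<times> L)"
    unfolding c_def using W(2) r L(2) hN by auto
  then have "finite (c ` X)" by (rule finite_subset) (use L(1) in auto)
  then show ?thesis
  proof (rule finite_quotient_if_code[OF _ equiv])
    fix x y assume xy: "x \<in> X" "y \<in> X" "c x = c y"
    let ?\<phi> = "inv_into (W y) (h y) \<circ> h x"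
    have eq: "card (W x) = card (W y)" "h x (r x) = h y (r y)"
      and lab: "(\<lambda>(u, v). (h x u, h x v, l x u v)) ` (W x \<times> W x)
         = (\<lambda>(u, v). (h y u, h y v, l y u v)) ` (W y \<times> W y)"
      using xy(3) unfolding c_def by auto
    have bij: "bij_betw ?\<phi> (W x) (W y)"
      using bij_betw_trans[OF h[OF xy(1)], of "inv_into (W y) (h y)" "W y"]
        bij_betw_inv_into[OF h[OF xy(2)]] eq by simp
    have inj: "inj_on (h y) (W y)" using h[OF xy(2)] bij_betw_def by blast
    have "?\<phi> (r x) = r y" using eq(2) r[OF xy(2)] inj by simp
    moreover have "l x u v = l y (?\<phi> u) (?\<phi> v)" if uv: "u \<in> W x" "v \<in> W x" for u v
    proof -
      have "(h x u, h x v, l x u v) \<in> (\<lambda>(u, v). (h y u, h y v, l y u v)) ` (W y \<times> W y)"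
        unfolding lab[symmetric] using uv by force
      then obtain u' v' where "u' \<in> W y" "v' \<in> W y" "h x u = h y u'" "h x v = h y v'"
        "l x u v = l y u' v'" by auto
      then show ?thesis using inj by simp
    qed
    ultimately have "isom x y"
      unfolding isom rooted_iso_def rooted_iso_map_def using bij by blast
    then show "(x, y) \<in> {(x, y). x \<in> X \<and> y \<in> X \<and> isom x y}" using xy by simp
  qed
qed

lemma equiv_rooted_iso:
  assumes isom: "\<And>x y. isom x y \<longleftrightarrow> rooted_iso (W x) (l x) (r x) (W y) (l y) (r y)"
    and r: "\<And>x. x \<in> X \<Longrightarrow> r x \<in> W x"
  shows "equiv X {(x, y). x \<in> X \<and> y \<in> X \<and> isom x y}"
proof (rule equivI)
  show "refl_on X {(x, y). x \<in> X \<and> y \<in> X \<and> isom x y}"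
    by (auto simp: refl_on_def isom rooted_iso_refl)
  show "sym {(x, y). x \<in> X \<and> y \<in> X \<and> isom x y}"
    unfolding sym_def isom using r by (auto intro: rooted_iso_sym)
  show "trans {(x, y). x \<in> X \<and> y \<in> X \<and> isom x y}"
    unfolding trans_def isom by (auto intro: rooted_iso_trans)
qed auto

lemma quotient_class_ex1:
  assumes "equiv X E" "x \<in> X"
  shows "\<exists>!\<Gamma>. \<Gamma> \<in> X // E \<and> x \<in> \<Gamma>"
proof (rule ex1I)
  show "E `` {x} \<in> X // E \<and> x \<in> E `` {x}"
    using equiv_class_self[OF assms] quotientI[OF assms(2)] by blast
  fix \<Gamma> assume "\<Gamma> \<in> X // E \<and> x \<in> \<Gamma>"
  then show "\<Gamma> = E `` {x}"
    using assms by (metis Image_singleton_iff equiv_class_eq_iff quotientE)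
qed


section \<open>Frequencies of coarser types\<close>

text \<open>
  If membership in the set \<open>P j i\<close> depends on the type of a vertex only, then this set is the
  union of the vertices of the types in a set \<open>K j\<close>, and its density is a sum of frequencies.
  The sets \<open>K j\<close> are disjoint, so the triangle inequality gives the bound.
\<close>

lemma sum_saturated_le_l1_dist:
  fixes V :: "'i \<Rightarrow> 'v set" and D :: "'i \<Rightarrow> 'v \<Rightarrow> 'r" and P :: "'j \<Rightarrow> 'i \<Rightarrow> 'v set"
  assumes T: "finite T"
    and V: "\<And>i. i \<in> I \<Longrightarrow> finite (V i)"
    and type: "\<And>i v. i \<in> I \<Longrightarrow> v \<in> V i \<Longrightarrow> \<exists>!\<Gamma>. \<Gamma> \<in> T \<and> D i v \<in> \<Gamma>"
    and J: "finite J"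
    and sub: "\<And>j i. j \<in> J \<Longrightarrow> i \<in> I \<Longrightarrow> P j i \<subseteq> V i"
    and disj: "\<And>j j' i v. j \<in> J \<Longrightarrow> j' \<in> J \<Longrightarrow> i \<in> I \<Longrightarrow> v \<in> P j i \<Longrightarrow> v \<in> P j' i \<Longrightarrow> j = j'"
    and sat: "\<And>j i i' v v' \<Gamma>. j \<in> J \<Longrightarrow> i \<in> I \<Longrightarrow> i' \<in> I \<Longrightarrow> \<Gamma> \<in> T \<Longrightarrow> v \<in> P j i \<Longrightarrow> v' \<in> V i' \<Longrightarrow>
       D i v \<in> \<Gamma> \<Longrightarrow> D i' v' \<in> \<Gamma> \<Longrightarrow> v' \<in> P j i'"
    and gh: "g \<in> I" "h \<in> I"
  shows "(\<Sum>j\<in>J. \<bar>real (card (P j g)) / real (card (V g)) - real (card (P j h)) / real (card (V h))\<bar>)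
     \<le> l1_dist T (frequency (V g) (D g)) (frequency (V h) (D h))"
proof -
  \<comment> \<open>By saturation, the vertices of a type in \<open>K j\<close> all lie in \<open>P j\<close>.\<close>
  define K where "K j = {\<Gamma> \<in> T. \<exists>i\<in>I. \<exists>v\<in>P j i. D i v \<in> \<Gamma>}" for j
  have finK: "finite (K j)" and KT: "K j \<subseteq> T" for j using T unfolding K_def by auto
  have freq: "real (card (P j i)) / real (card (V i)) = (\<Sum>\<Gamma>\<in>K j. frequency (V i) (D i) \<Gamma>)"
    if ji: "j \<in> J" "i \<in> I" for i j
  proof -
    have "P j i = (\<Union>\<Gamma>\<in>K j. {v \<in> V i. D i v \<in> \<Gamma>})"
    proof (intro set_eqI iffI)
      fix v assume v: "v \<in> P j i"
      then have "v \<in> V i" using sub ji by blast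
      then show "v \<in> (\<Union>\<Gamma>\<in>K j. {v \<in> V i. D i v \<in> \<Gamma>})"
        using type[OF ji(2)] v ji(2) unfolding K_def by fastforce
    next
      fix v assume "v \<in> (\<Union>\<Gamma>\<in>K j. {v \<in> V i. D i v \<in> \<Gamma>})"
      then show "v \<in> P j i" using sat ji unfolding K_def by blast
    qed
    moreover have "card (\<Union>\<Gamma>\<in>K j. {v \<in> V i. D i v \<in> \<Gamma>}) = (\<Sum>\<Gamma>\<in>K j. card {v \<in> V i. D i v \<in> \<Gamma>})"
    proof (rule card_UN_disjoint[OF finK])
      show "\<forall>\<Gamma>\<in>K j. finite {v \<in> V i. D i v \<in> \<Gamma>}" using V ji by simp
      show "\<forall>\<Gamma>\<in>K j. \<forall>\<Gamma>'\<in>K j. \<Gamma> \<noteq> \<Gamma>' \<longrightarrow> {v \<in> V i. D i v \<in> \<Gamma>} \<inter> {v \<in> V i. D i v \<in> \<Gamma>'} = {}"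
        using type[OF ji(2)] KT by blast
    qed
    ultimately show ?thesis
      by (simp add: frequency_def sum_divide_distrib)
  qed
  let ?d = "\<lambda>\<Gamma>. \<bar>frequency (V g) (D g) \<Gamma> - frequency (V h) (D h) \<Gamma>\<bar>"
  have "(\<Sum>j\<in>J. \<bar>real (card (P j g)) / real (card (V g)) - real (card (P j h)) / real (card (V h))\<bar>)
     \<le> (\<Sum>j\<in>J. \<Sum>\<Gamma>\<in>K j. ?d \<Gamma>)"
    by (intro sum_mono) (simp add: freq gh sum_subtractf[symmetric])
  also have "\<dots> = (\<Sum>\<Gamma>\<in>(\<Union>j\<in>J. K j). ?d \<Gamma>)"
  proof (rule sum.UNION_disjoint[symmetric, OF J])
    show "\<forall>j\<in>J. finite (K j)" using finK by simp
    show "\<forall>j\<in>J. \<forall>j'\<in>J. j \<noteq> j' \<longrightarrow> K j \<inter> K j' = {}"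
    proof (intro ballI impI, rule ccontr)
      fix j j' assume j: "j \<in> J" "j' \<in> J" "j \<noteq> j'" "K j \<inter> K j' \<noteq> {}"
      then obtain \<Gamma> i v i' v' where *: "\<Gamma> \<in> T" "i \<in> I" "v \<in> P j i" "D i v \<in> \<Gamma>"
          "i' \<in> I" "v' \<in> P j' i'" "D i' v' \<in> \<Gamma>" unfolding K_def by blast
      then have "v' \<in> P j i'" using sat[OF j(1) *(2) *(5) *(1) *(3) _ *(4) *(7)] sub j by blast
      then show False using disj * j by blast
    qed
  qed
  also have "\<dots> \<le> (\<Sum>\<Gamma>\<in>T. ?d \<Gamma>)"
    using T KT by (intro sum_mono2) auto
  finally show ?thesis unfolding l1_dist_def .
qed

text \<open>
  The family \<open>M\<close> consists of the vertices that survive in a derived graph, and \<open>D'\<close> gives their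
  discs there; \<open>satM\<close> and \<open>satD\<close> say that both are determined by the disc types \<open>T\<close> of the
  original graph.  The term \<open>\<bar>\<mu> g - \<mu> h\<bar>\<close> is the price of normalising by different
  proportions: with \<open>f\<close> the frequency vectors of the derived graphs,
  \<open>(f g - f h) * \<mu> g\<close> differs from \<open>f g * \<mu> g - f h * \<mu> h\<close> by \<open>f h * (\<mu> g - \<mu> h)\<close>,
  and the entries of \<open>f h\<close> sum to at most one.
\<close>

lemma l1_dist_frequency_transfer:
  fixes V M :: "'i \<Rightarrow> 'v set" and D :: "'i \<Rightarrow> 'v \<Rightarrow> 'r" and D' :: "'i \<Rightarrow> 'v \<Rightarrow> 'q"
  assumes T: "finite T" "finite T'"
    and V: "\<And>i. i \<in> I \<Longrightarrow> finite (V i)"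
    and type: "\<And>i v. i \<in> I \<Longrightarrow> v \<in> V i \<Longrightarrow> \<exists>!\<Gamma>. \<Gamma> \<in> T \<and> D i v \<in> \<Gamma>"
    and M: "\<And>i. i \<in> I \<Longrightarrow> M i \<subseteq> V i"
    and type': "\<And>i v. i \<in> I \<Longrightarrow> v \<in> M i \<Longrightarrow> \<exists>!\<Gamma>. \<Gamma> \<in> T' \<and> D' i v \<in> \<Gamma>"
    and satM: "\<And>i i' v v' \<Gamma>. i \<in> I \<Longrightarrow> i' \<in> I \<Longrightarrow> \<Gamma> \<in> T \<Longrightarrow> v \<in> M i \<Longrightarrow> v' \<in> V i' \<Longrightarrow>
       D i v \<in> \<Gamma> \<Longrightarrow> D i' v' \<in> \<Gamma> \<Longrightarrow> v' \<in> M i'"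
    and satD: "\<And>i i' v v' \<Gamma> \<Gamma>'. i \<in> I \<Longrightarrow> i' \<in> I \<Longrightarrow> \<Gamma> \<in> T \<Longrightarrow> v \<in> M i \<Longrightarrow> v' \<in> M i' \<Longrightarrow>
       D i v \<in> \<Gamma> \<Longrightarrow> D i' v' \<in> \<Gamma> \<Longrightarrow> \<Gamma>' \<in> T' \<Longrightarrow> D' i v \<in> \<Gamma>' \<Longrightarrow> D' i' v' \<in> \<Gamma>'"
    and gh: "g \<in> I" "h \<in> I"
  defines "\<mu> \<equiv> \<lambda>i. real (card (M i)) / real (card (V i))"
    and "\<delta> \<equiv> l1_dist T (frequency (V g) (D g)) (frequency (V h) (D h))"
  shows "\<bar>\<mu> g - \<mu> h\<bar> \<le> \<delta>"
    and "M g \<noteq> {} \<Longrightarrow> M h \<noteq> {} \<Longrightarrow>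
       l1_dist T' (frequency (M g) (D' g)) (frequency (M h) (D' h)) * \<mu> g \<le> \<delta> + \<bar>\<mu> g - \<mu> h\<bar>"
proof -
  have "(\<Sum>j\<in>{()}. \<bar>real (card (M g)) / real (card (V g)) - real (card (M h)) / real (card (V h))\<bar>) \<le> \<delta>"
    unfolding \<delta>_def
    by (rule sum_saturated_le_l1_dist[where P = "\<lambda>_. M" and I = I, OF T(1) V type _ _ _ _ gh])
      (use M satM in blast)+
  then show "\<bar>\<mu> g - \<mu> h\<bar> \<le> \<delta>" by (simp add: \<mu>_def)
next
  assume ne: "M g \<noteq> {}" "M h \<noteq> {}"
  let ?P = "\<lambda>\<Gamma> i. {v \<in> M i. D' i v \<in> \<Gamma>}"
  let ?N = "\<lambda>i \<Gamma>. real (card (?P \<Gamma> i)) / real (card (V i))"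
  let ?f = "\<lambda>i. frequency (M i) (D' i)"
  have *: "(\<Sum>\<Gamma>\<in>T'. \<bar>?N g \<Gamma> - ?N h \<Gamma>\<bar>) \<le> \<delta>"
    unfolding \<delta>_def
  proof (rule sum_saturated_le_l1_dist[where P = ?P and I = I, OF T(1) V type T(2) _ _ _ gh])
    show "\<And>j i. j \<in> T' \<Longrightarrow> i \<in> I \<Longrightarrow> {v \<in> M i. D' i v \<in> j} \<subseteq> V i" using M by blast
    show "\<And>j j' i v. j \<in> T' \<Longrightarrow> j' \<in> T' \<Longrightarrow> i \<in> I \<Longrightarrow> v \<in> {v \<in> M i. D' i v \<in> j} \<Longrightarrow>
       v \<in> {v \<in> M i. D' i v \<in> j'} \<Longrightarrow> j = j'" using type' by blast
    show "\<And>j i i' v v' \<Gamma>. j \<in> T' \<Longrightarrow> i \<in> I \<Longrightarrow> i' \<in> I \<Longrightarrow> \<Gamma> \<in> T \<Longrightarrow> v \<in> {v \<in> M i. D' i v \<in> j} \<Longrightarrow>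
       v' \<in> V i' \<Longrightarrow> D i v \<in> \<Gamma> \<Longrightarrow> D i' v' \<in> \<Gamma> \<Longrightarrow> v' \<in> {v \<in> M i'. D' i' v \<in> j}"
      using satM satD by blast
  qed auto
  have fin: "finite (M i)" if "i \<in> I" for i using that M V finite_subset by blast
  have N: "?f i \<Gamma> * \<mu> i = ?N i \<Gamma>" if "i \<in> I" "M i \<noteq> {}" for i \<Gamma>
    using fin that by (simp add: frequency_def \<mu>_def)
  have "(\<Sum>\<Gamma>\<in>T'. card (?P \<Gamma> h)) = card (\<Union>\<Gamma>\<in>T'. ?P \<Gamma> h)"
  proof (rule card_UN_disjoint[symmetric, OF T(2)])
    show "\<forall>\<Gamma>\<in>T'. finite (?P \<Gamma> h)" using fin gh by simp
    show "\<forall>\<Gamma>\<in>T'. \<forall>\<Gamma>'\<in>T'. \<Gamma> \<noteq> \<Gamma>' \<longrightarrow> ?P \<Gamma> h \<inter> ?P \<Gamma>' h = {}" using type'[OF gh(2)] by blast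
  qed
  also have "\<dots> \<le> card (M h)" using fin gh by (intro card_mono) auto
  finally have "(\<Sum>\<Gamma>\<in>T'. ?f h \<Gamma>) \<le> 1"
    by (simp add: frequency_def sum_divide_distrib[symmetric] divide_le_eq_1 flip: of_nat_sum) auto
  then have 1: "(\<Sum>\<Gamma>\<in>T'. ?f h \<Gamma>) * \<bar>\<mu> g - \<mu> h\<bar> \<le> \<bar>\<mu> g - \<mu> h\<bar>"
    by (rule mult_left_le_one_le[OF abs_ge_zero, rotated]) (simp add: frequency_def sum_nonneg)
  have "\<mu> g \<ge> 0" by (simp add: \<mu>_def)
  then have "l1_dist T' (?f g) (?f h) * \<mu> g = (\<Sum>\<Gamma>\<in>T'. \<bar>?f g \<Gamma> * \<mu> g - ?f h \<Gamma> * \<mu> g\<bar>)"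
    by (simp add: l1_dist_def sum_distrib_right left_diff_distrib[symmetric] abs_mult)
  also have "\<dots> \<le> (\<Sum>\<Gamma>\<in>T'. \<bar>?N g \<Gamma> - ?N h \<Gamma>\<bar> + ?f h \<Gamma> * \<bar>\<mu> g - \<mu> h\<bar>)"
  proof (rule sum_mono)
    fix \<Gamma>
    have "\<bar>?f g \<Gamma> * \<mu> g - ?f h \<Gamma> * \<mu> g\<bar> = \<bar>(?N g \<Gamma> - ?N h \<Gamma>) - ?f h \<Gamma> * (\<mu> g - \<mu> h)\<bar>"
      using N gh ne by (simp add: right_diff_distrib)
    also have "\<dots> \<le> \<bar>?N g \<Gamma> - ?N h \<Gamma>\<bar> + \<bar>?f h \<Gamma> * (\<mu> g - \<mu> h)\<bar>" by (rule abs_triangle_ineq4)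
    finally show "\<bar>?f g \<Gamma> * \<mu> g - ?f h \<Gamma> * \<mu> g\<bar> \<le> \<bar>?N g \<Gamma> - ?N h \<Gamma>\<bar> + ?f h \<Gamma> * \<bar>\<mu> g - \<mu> h\<bar>"
      by (simp add: abs_mult frequency_def)
  qed
  also have "\<dots> = (\<Sum>\<Gamma>\<in>T'. \<bar>?N g \<Gamma> - ?N h \<Gamma>\<bar>) + (\<Sum>\<Gamma>\<in>T'. ?f h \<Gamma>) * \<bar>\<mu> g - \<mu> h\<bar>"
    by (simp add: sum.distrib sum_distrib_right)
  finally show "l1_dist T' (?f g) (?f h) * \<mu> g \<le> \<delta> + \<bar>\<mu> g - \<mu> h\<bar>"
    using * 1 by linarith
qed


section \<open>Discs as balls\<close>

lemma simple_adj_subset: "simple_graph G \<Longrightarrow> simple_adj G \<subseteq> nodes G \<times> nodes G"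
  by (auto simp: simple_graph_def simple_adj_def)

lemma sym_simple_adj: "(x, y) \<in> simple_adj G \<Longrightarrow> (y, x) \<in> simple_adj G"
  by (simp add: simple_adj_def insert_commute)

lemma Omega_info_Some:
  assumes "G \<in> Omega S" "info G (u, v) = Some s"
  shows "u \<in> verts G" "v \<in> verts G" "s \<in> S"
proof -
  have "u \<notin> verts G \<or> v \<notin> verts G \<longrightarrow> info G (u, v) = None"
    and lab: "\<forall>u\<in>verts G. \<forall>v\<in>verts G. info G (u, v) \<in> {None} \<union> Some ` S"
    using assms(1) by (simp_all add: Omega_def)
  then show "u \<in> verts G" "v \<in> verts G" using assms(2) by auto
  then show "s \<in> S" using lab assms(2) by fastforce
qed

lemma info_adj_subset: "G \<in> Omega S \<Longrightarrow> info_adj G \<subseteq> verts G \<times> verts G"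
  using Omega_info_Some(1,2) by (fastforce simp: info_adj_def)

lemma simple_degree:
  assumes "simple_graph G"
  shows "card {e \<in> edges G. v \<in> e} = card (simple_adj G `` {v})"
proof -
  have "{e \<in> edges G. v \<in> e} = (\<lambda>u. {v, u}) ` (simple_adj G `` {v})"
  proof (intro set_eqI iffI)
    fix e assume "e \<in> {e \<in> edges G. v \<in> e}"
    then obtain a b where "e \<in> edges G" "v \<in> e" "e = {a, b}"
      using assms unfolding simple_graph_def by (auto simp: card_2_iff)
    then show "e \<in> (\<lambda>u. {v, u}) ` (simple_adj G `` {v})"
      by (auto simp: simple_adj_def insert_commute)
  qed (auto simp: simple_adj_def)
  moreover have "inj_on (\<lambda>u. {v, u}) (simple_adj G `` {v})"
    by (auto simp: inj_on_def doubleton_eq_iff)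
  ultimately show ?thesis by (simp add: card_image)
qed

lemma simple_bounded_iff:
  "simple_graph G \<Longrightarrow> simple_bounded d G \<longleftrightarrow> (\<forall>v\<in>nodes G. card (simple_adj G `` {v}) \<le> d)"
  by (simp add: simple_bounded_def simple_degree)

lemma info_neighbours: "G \<in> Omega S \<Longrightarrow> {u \<in> verts G. (v, u) \<in> info_adj G} = info_adj G `` {v}"
  using info_adj_subset by blast

lemma simple_disc_eq:
  assumes "simple_graph G" "v \<in> nodes G"
  shows "simple_disc k G v = (simple_induced G (ball (simple_adj G) v k), v)"
proof -
  have "{u \<in> nodes G. walk_dist (simple_adj G) v u \<le> enat k} = ball (simple_adj G) v k"
    using ball_subset[OF assms(2) simple_adj_subset[OF assms(1)]] by (auto simp: walk_dist_le_iff)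
  then show ?thesis by (simp add: simple_disc_def)
qed

lemma info_disc_eq:
  assumes "G \<in> Omega S" "v \<in> verts G"
  shows "info_disc k G v = (info_induced G (ball (info_adj G) v k), v)"
proof -
  have "{u \<in> verts G. walk_dist (info_adj G) v u \<le> enat k} = ball (info_adj G) v k"
    using ball_subset[OF assms(2) info_adj_subset[OF assms(1)]] by (auto simp: walk_dist_le_iff)
  then show ?thesis by (simp add: info_disc_def)
qed

lemma verts_info_induced: "verts (info_induced G W) = W"
  by (simp add: info_induced_def)

abbreviation rooted_adj_iso_map where
  "rooted_adj_iso_map \<phi> R x R' x' k \<equiv>
     rooted_iso_map \<phi> (ball R x k) (\<lambda>y z. (y, z) \<in> R) x (ball R' x' k) (\<lambda>y z. (y, z) \<in> R') x'"

abbreviation rooted_info_iso_map where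
  "rooted_info_iso_map \<phi> G x G' x' k \<equiv>
     rooted_iso_map \<phi> (ball (info_adj G) x k) (\<lambda>y z. info G (y, z)) x
       (ball (info_adj G') x' k) (\<lambda>y z. info G' (y, z)) x'"

lemma simple_rooted_iso_disc_iff:
  assumes "simple_graph G" "v \<in> nodes G" "simple_graph G'" "v' \<in> nodes G'"
  shows "simple_rooted_iso (simple_disc k G v) (simple_disc k G' v') \<longleftrightarrow>
    (\<exists>\<phi>. rooted_adj_iso_map \<phi> (simple_adj G) v (simple_adj G') v' k)"
proof -
  have "({x, y} \<in> {e \<in> edges G. e \<subseteq> ball (simple_adj G) v k}
        \<longleftrightarrow> {\<phi> x, \<phi> y} \<in> {e \<in> edges G'. e \<subseteq> ball (simple_adj G') v' k})
      \<longleftrightarrow> ((x, y) \<in> simple_adj G \<longleftrightarrow> (\<phi> x, \<phi> y) \<in> simple_adj G')"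
    if "bij_betw \<phi> (ball (simple_adj G) v k) (ball (simple_adj G') v' k)"
      "x \<in> ball (simple_adj G) v k" "y \<in> ball (simple_adj G) v k" for \<phi> x y
    using bij_betw_apply[OF that(1)] that(2,3) by (auto simp: simple_adj_def)
  then show ?thesis
    unfolding simple_rooted_iso_def rooted_iso_map_def
    by (simp add: simple_disc_eq assms simple_induced_def cong: conj_cong)
qed

lemma info_rooted_iso_disc_iff:
  assumes "G \<in> Omega S" "v \<in> verts G" "G' \<in> Omega S'" "v' \<in> verts G'"
  shows "info_rooted_iso (info_disc k G v) (info_disc k G' v') \<longleftrightarrow>
    (\<exists>\<phi>. rooted_info_iso_map \<phi> G v G' v' k)"
proof -
  have "info (info_induced G (ball (info_adj G) v k)) (x, y)
        = info (info_induced G' (ball (info_adj G') v' k)) (\<phi> x, \<phi> y)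
      \<longleftrightarrow> info G (x, y) = info G' (\<phi> x, \<phi> y)"
    if "bij_betw \<phi> (ball (info_adj G) v k) (ball (info_adj G') v' k)"
      "x \<in> ball (info_adj G) v k" "y \<in> ball (info_adj G) v k" for \<phi> x y
    using bij_betw_apply[OF that(1)] that(2,3) by (simp add: info_induced_def)
  then show ?thesis
    unfolding info_rooted_iso_def rooted_iso_map_def info_disc_eq[OF assms(1,2)] info_disc_eq[OF assms(3,4)]
      fst_conv snd_conv verts_info_induced by (simp cong: conj_cong)
qed

text \<open>
  An isomorphism of \<open>k\<close>-discs sees all neighbours of a vertex at distance less than \<open>k\<close>, so there
  it is a bijection of whole neighbourhoods in the ambient graphs.
\<close>

lemma rooted_adj_iso_map_neighbours:
  assumes \<phi>: "rooted_adj_iso_map \<phi> R x R' x' k" and y: "y \<in> ball R x j" and "j < k"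
  shows "R' `` {\<phi> y} = \<phi> ` (R `` {y})"
proof -
  have bij: "bij_betw \<phi> (ball R x k) (ball R' x' k)" and root: "\<phi> x = x'"
    and adj: "\<And>y z. y \<in> ball R x k \<Longrightarrow> z \<in> ball R x k \<Longrightarrow> (y, z) \<in> R \<longleftrightarrow> (\<phi> y, \<phi> z) \<in> R'"
    using \<phi> unfolding rooted_iso_map_def by auto
  have main: "R' `` {\<phi> y} = \<phi> ` (R `` {y})"
    if y: "y \<in> ball R x i" "i < k" and im: "\<phi> ` ball R x i = ball R' x' i" for i y
  proof (intro set_eqI iffI)
    have yk: "y \<in> ball R x k" using y ball_mono[of i k R x] by auto
    fix z
    {
      assume "z \<in> R' `` {\<phi> y}"
      then have z: "(\<phi> y, z) \<in> R'" by simp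
      have "\<phi> y \<in> ball R' x' i" using im y by blast
      then have "z \<in> ball R' x' k" using z ball_step y(2) by (metis Suc_leI)
      then obtain u where "u \<in> ball R x k" "z = \<phi> u" using bij unfolding bij_betw_def by blast
      then show "z \<in> \<phi> ` (R `` {y})" using adj yk z by blast
    next
      assume "z \<in> \<phi> ` (R `` {y})"
      then obtain u where u: "(y, u) \<in> R" "z = \<phi> u" by blast
      then have "u \<in> ball R x k" using y ball_step by (metis Suc_leI)
      then show "z \<in> R' `` {\<phi> y}" using adj yk u by blast
    }
  qed
  have "\<phi> ` ball R x i = ball R' x' i" if "i \<le> k" for i
    using that
  proof (induction i rule: less_induct)
    case (less i)
    then show ?case
      using image_ball[of i R x R' \<phi>] main root by (metis less_le_trans order_less_imp_le)
  qed
  then show ?thesis using main y \<open>j < k\<close> by simp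
qed

lemma rooted_adj_iso_map_image_ball:
  assumes \<phi>: "rooted_adj_iso_map \<phi> R x R' x' k" and "j \<le> k"
  shows "\<phi> ` ball R x j = ball R' x' j"
proof -
  have "\<phi> x = x'" using \<phi> unfolding rooted_iso_map_def by simp
  then show ?thesis
    using image_ball[of j R x R' \<phi>] rooted_adj_iso_map_neighbours[OF \<phi>] \<open>j \<le> k\<close> by simp
qed

lemma rooted_info_iso_map_adj:
  assumes "rooted_info_iso_map \<phi> G x G' x' k"
  shows "rooted_adj_iso_map \<phi> (info_adj G) x (info_adj G') x' k"
proof -
  let ?B = "ball (info_adj G) x k"
  have \<phi>: "bij_betw \<phi> ?B (ball (info_adj G') x' k)" "\<phi> x = x'"
    and info: "\<And>y z. y \<in> ?B \<Longrightarrow> z \<in> ?B \<Longrightarrow> info G (y, z) = info G' (\<phi> y, \<phi> z)"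
    using assms unfolding rooted_iso_map_def by blast+
  have "(y, z) \<in> info_adj G \<longleftrightarrow> (\<phi> y, \<phi> z) \<in> info_adj G'" if "y \<in> ?B" "z \<in> ?B" for y z
    using info[OF that] info[OF that(2,1)] inj_on_eq_iff[OF bij_betw_imp_inj_on[OF \<phi>(1)] that]
    unfolding info_adj_def by simp
  then show ?thesis using \<phi> unfolding rooted_iso_map_def by blast
qed


section \<open>Finiteness of the disc types\<close>

lemma simple_discs_bound:
  assumes "D \<in> simple_discs d k"
  shows "finite (nodes (fst D))" "card (nodes (fst D)) \<le> Suc d ^ k" "snd D \<in> nodes (fst D)"
proof -
  from assms obtain G v where D: "D = simple_disc k G v" "simple_graph G" "simple_bounded d G" "v \<in> nodes G"
    unfolding simple_discs_def by blast
  then have eq: "nodes (fst D) = ball (simple_adj G) v k" "snd D = v"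
    by (simp_all add: simple_disc_eq simple_induced_def)
  have fin: "finite (nodes G)" using D unfolding simple_graph_def by simp
  then show "finite (nodes (fst D))"
    unfolding eq using ball_subset[OF D(4) simple_adj_subset[OF D(2)]] finite_subset by blast
  show "snd D \<in> nodes (fst D)" unfolding eq by (rule center_in_ball)
  show "card (nodes (fst D)) \<le> Suc d ^ k" unfolding eq
    by (rule card_ball_le[OF D(4) simple_adj_subset[OF D(2)] fin])
      (use D simple_bounded_iff in blast)
qed

lemma info_discs_bound:
  assumes "D \<in> info_discs S d k"
  shows "finite (verts (fst D))" "card (verts (fst D)) \<le> Suc d ^ k" "snd D \<in> verts (fst D)"
    and "info (fst D) (x, y) \<in> insert None (Some ` S)"
proof -
  from assms obtain G v where D: "D = info_disc k G v" "G \<in> Omega S" "info_bounded d G" "v \<in> verts G"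
    unfolding info_discs_def by blast
  then have eq: "fst D = info_induced G (ball (info_adj G) v k)" "snd D = v"
    by (simp_all add: info_disc_eq)
  have eq': "verts (fst D) = ball (info_adj G) v k" by (simp add: eq info_induced_def)
  have fin: "finite (verts G)" using D unfolding Omega_def by simp
  then show "finite (verts (fst D))"
    unfolding eq' using ball_subset[OF D(4) info_adj_subset[OF D(2)]] finite_subset by blast
  show "snd D \<in> verts (fst D)" unfolding eq' eq(2) by (rule center_in_ball)
  show "card (verts (fst D)) \<le> Suc d ^ k" unfolding eq'
  proof (rule card_ball_le[OF D(4) info_adj_subset[OF D(2)] fin])
    fix y assume "y \<in> verts G"
    then show "card (info_adj G `` {y}) \<le> d"
      using D(3) info_neighbours[OF D(2), of y] unfolding info_bounded_def by fastforce
  qed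
  show "info (fst D) (x, y) \<in> insert None (Some ` S)"
    using D(2) unfolding eq info_induced_def Omega_def by auto
qed

lemma simple_rooted_iso_iff:
  "simple_rooted_iso D D' \<longleftrightarrow> rooted_iso (nodes (fst D)) (\<lambda>x y. {x, y} \<in> edges (fst D)) (snd D)
     (nodes (fst D')) (\<lambda>x y. {x, y} \<in> edges (fst D')) (snd D')"
  unfolding simple_rooted_iso_def rooted_iso_def rooted_iso_map_def ..

lemma info_rooted_iso_iff:
  "info_rooted_iso D D' \<longleftrightarrow> rooted_iso (verts (fst D)) (\<lambda>x y. info (fst D) (x, y)) (snd D)
     (verts (fst D')) (\<lambda>x y. info (fst D') (x, y)) (snd D')"
  unfolding info_rooted_iso_def rooted_iso_def rooted_iso_map_def ..

lemma equiv_simple_discs: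
  "equiv (simple_discs d k)
     {(D, D'). D \<in> simple_discs d k \<and> D' \<in> simple_discs d k \<and> simple_rooted_iso D D'}"
  by (rule equiv_rooted_iso[OF simple_rooted_iso_iff simple_discs_bound(3)])

lemma equiv_info_discs:
  "equiv (info_discs S d k)
     {(D, D'). D \<in> info_discs S d k \<and> D' \<in> info_discs S d k \<and> info_rooted_iso D D'}"
  by (rule equiv_rooted_iso[OF info_rooted_iso_iff info_discs_bound(3)])

lemma finite_simple_disc_types: "finite (simple_disc_types d k)"
  unfolding simple_disc_types_def
  by (rule finite_rooted_iso_types[OF equiv_simple_discs simple_rooted_iso_iff simple_discs_bound(1-3),
        where L = UNIV]) auto

lemma finite_info_disc_types: "finite S \<Longrightarrow> finite (info_disc_types S d k)"
  unfolding info_disc_types_def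
  by (rule finite_rooted_iso_types[OF equiv_info_discs info_rooted_iso_iff info_discs_bound(1-3),
        where L = "insert None (Some ` S)"]) (assumption | rule info_discs_bound(4) | simp)+

lemma simple_disc_in_discs:
  "simple_graph G \<Longrightarrow> simple_bounded d G \<Longrightarrow> v \<in> nodes G \<Longrightarrow> simple_disc k G v \<in> simple_discs d k"
  by (auto simp: simple_discs_def)

lemma info_disc_in_discs:
  "G \<in> Omega S \<Longrightarrow> info_bounded d G \<Longrightarrow> v \<in> verts G \<Longrightarrow> info_disc k G v \<in> info_discs S d k"
  by (auto simp: info_discs_def)

lemma simple_disc_type_ex1:
  assumes "simple_graph G" "simple_bounded d G" "v \<in> nodes G"
  shows "\<exists>!\<Gamma>. \<Gamma> \<in> simple_disc_types d k \<and> simple_disc k G v \<in> \<Gamma>"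
  unfolding simple_disc_types_def
  by (rule quotient_class_ex1[OF equiv_simple_discs simple_disc_in_discs[OF assms]])

lemma info_disc_type_ex1:
  assumes "G \<in> Omega S" "info_bounded d G" "v \<in> verts G"
  shows "\<exists>!\<Gamma>. \<Gamma> \<in> info_disc_types S d k \<and> info_disc k G v \<in> \<Gamma>"
  unfolding info_disc_types_def
  by (rule quotient_class_ex1[OF equiv_info_discs info_disc_in_discs[OF assms]])

lemma simple_disc_type_iso:
  assumes "\<Gamma> \<in> simple_disc_types d k" "D \<in> \<Gamma>" "D' \<in> \<Gamma>"
  shows "simple_rooted_iso D D'"
  using quotient_eq_iff[OF equiv_simple_discs assms(1,1)[unfolded simple_disc_types_def] assms(2,3)] by simp

lemma info_disc_type_iso:
  assumes "\<Gamma> \<in> info_disc_types S d k" "D \<in> \<Gamma>" "D' \<in> \<Gamma>"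
  shows "info_rooted_iso D D'"
  using quotient_eq_iff[OF equiv_info_discs assms(1,1)[unfolded info_disc_types_def] assms(2,3)] by simp

lemma simple_disc_type_closed:
  assumes "\<Gamma> \<in> simple_disc_types d k" "D \<in> \<Gamma>" "simple_rooted_iso D D'" "D' \<in> simple_discs d k"
  shows "D' \<in> \<Gamma>"
proof -
  have "D \<in> simple_discs d k"
    using in_quotient_imp_subset[OF equiv_simple_discs assms(1)[unfolded simple_disc_types_def]] assms(2) by blast
  then show ?thesis
    using in_quotient_imp_closed[OF equiv_simple_discs assms(1)[unfolded simple_disc_types_def] assms(2)]
      assms(3,4) by blast
qed

lemma info_disc_type_closed:
  assumes "\<Gamma> \<in> info_disc_types S d k" "D \<in> \<Gamma>" "info_rooted_iso D D'" "D' \<in> info_discs S d k"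
  shows "D' \<in> \<Gamma>"
proof -
  have "D \<in> info_discs S d k"
    using in_quotient_imp_subset[OF equiv_info_discs assms(1)[unfolded info_disc_types_def]] assms(2) by blast
  then show ?thesis
    using in_quotient_imp_closed[OF equiv_info_discs assms(1)[unfolded info_disc_types_def] assms(2)]
      assms(3,4) by blast
qed


section \<open>The underlying simple graph\<close>

lemma nodes_underlying [simp]: "nodes (underlying G) = verts G"
  by (simp add: underlying_def)

lemma simple_adj_underlying: "G \<in> Omega S \<Longrightarrow> simple_adj (underlying G) = info_adj G"
  using info_adj_subset[of G S]
  by (fastforce simp: underlying_def simple_adj_def doubleton_eq_iff info_adj_def)

lemma simple_graph_underlying:
  assumes "G \<in> Omega S"
  shows "simple_graph (underlying G)"
proof -
  have "finite (verts G)" using assms by (simp add: Omega_def)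
  then show ?thesis unfolding simple_graph_def underlying_def by (auto simp: info_adj_def card_2_iff)
qed

lemma simple_bounded_underlying:
  assumes "G \<in> Omega S" "info_bounded d G"
  shows "simple_bounded d (underlying G)"
  using assms(2) info_neighbours[OF assms(1)] unfolding info_bounded_def
  by (auto simp: simple_bounded_iff[OF simple_graph_underlying[OF assms(1)]] simple_adj_underlying[OF assms(1)]
      split: if_splits)

lemma underlying_disc_iso:
  assumes "G \<in> Omega S" "v \<in> verts G" "G' \<in> Omega S" "v' \<in> verts G'"
    and "info_rooted_iso (info_disc k G v) (info_disc k G' v')"
  shows "simple_rooted_iso (simple_disc k (underlying G) v) (simple_disc k (underlying G') v')"
  using assms simple_rooted_iso_disc_iff[of "underlying G" v "underlying G'" v' k]
    info_rooted_iso_disc_iff[OF assms(1-4), of k] rooted_info_iso_map_adj[of _ G v k G' v']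
  by (auto simp: simple_graph_underlying simple_adj_underlying)

lemma underlying_freq_dist_le:
  fixes G H :: "('v, 's) igraph"
  assumes S: "finite S" and G: "G \<in> Omega S" "info_bounded d G" "verts G \<noteq> {}"
    and H: "H \<in> Omega S" "info_bounded d H" "verts H \<noteq> {}"
  shows "simple_freq_dist d k (underlying G) (underlying H) \<le> info_freq_dist S d k G H"
proof -
  let ?I = "{G :: ('v, 's) igraph. G \<in> Omega S \<and> info_bounded d G}"
  have fin: "finite (verts G)" if "G \<in> ?I" for G :: "('v, 's) igraph" using that by (simp add: Omega_def)
  have U: "simple_graph (underlying G)" "simple_bounded d (underlying G)"
    if "G \<in> ?I" for G :: "('v, 's) igraph"
    using that simple_graph_underlying simple_bounded_underlying by auto
  have type': "\<exists>!\<Gamma>. \<Gamma> \<in> simple_disc_types d k \<and> simple_disc k (underlying G) v \<in> \<Gamma>"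
    if "G \<in> ?I" "v \<in> verts G" for G :: "('v, 's) igraph" and v
    using simple_disc_type_ex1[OF U[OF that(1)]] that(2) by simp
  have sat: "simple_disc k (underlying G') v' \<in> \<Gamma>'"
    if "G \<in> ?I" "G' \<in> ?I" "\<Gamma> \<in> info_disc_types S d k" "v \<in> verts G" "v' \<in> verts G'"
      "info_disc k G v \<in> \<Gamma>" "info_disc k G' v' \<in> \<Gamma>" "\<Gamma>' \<in> simple_disc_types d k"
      "simple_disc k (underlying G) v \<in> \<Gamma>'" for G G' :: "('v, 's) igraph" and \<Gamma> \<Gamma>' v v'
    using that(8,9)
  proof (rule simple_disc_type_closed)
    show "simple_rooted_iso (simple_disc k (underlying G) v) (simple_disc k (underlying G') v')"
      using that by (intro underlying_disc_iso[OF _ _ _ _ info_disc_type_iso[OF that(3,6,7)]]) auto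
    show "simple_disc k (underlying G') v' \<in> simple_discs d k"
      using U[OF that(2)] that(5) by (simp add: simple_disc_in_discs)
  qed
  have type: "\<exists>!\<Gamma>. \<Gamma> \<in> info_disc_types S d k \<and> info_disc k G v \<in> \<Gamma>"
    if "G \<in> ?I" "v \<in> verts G" for G :: "('v, 's) igraph" and v
    by (rule info_disc_type_ex1) (use that in auto)
  have "G \<in> ?I" "H \<in> ?I" using G H by auto
  note dist = l1_dist_frequency_transfer(2)[where I = ?I and M = verts and V = verts,
      OF finite_info_disc_types[OF S] finite_simple_disc_types fin type order_refl type' _ sat this G(3) H(3)]
  have "l1_dist (simple_disc_types d k)
       (frequency (verts G) (simple_disc k (underlying G))) (frequency (verts H) (simple_disc k (underlying H)))
     * (real (card (verts G)) / real (card (verts G)))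
    \<le> l1_dist (info_disc_types S d k) (frequency (verts G) (info_disc k G)) (frequency (verts H) (info_disc k H))
      + \<bar>real (card (verts G)) / real (card (verts G)) - real (card (verts H)) / real (card (verts H))\<bar>"
    by (rule dist)
  moreover have "card (verts G) > 0" "card (verts H) > 0"
    using G H by (auto simp: card_gt_0_iff Omega_def)
  ultimately show ?thesis
    by (simp add: simple_freq_dist_def info_freq_dist_def simple_freq_def[abs_def] info_freq_def[abs_def])
qed


section \<open>Bounding the degree of an \<open>S\<close>-graph\<close>

definition info_degree :: "('v, 's) igraph \<Rightarrow> 'v \<Rightarrow> nat" where
  "info_degree G v = card (info_adj G `` {v}) + (if info G (v, v) \<noteq> None then 2 else 0)"

text \<open>
  Deleting the edges at the vertices of degree larger than \<open>d\<close> is a local way to enforce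
  the degree bound.  It leaves \<open>d\<close>-bounded graphs unchanged.
\<close>

definition cap_degree :: "nat \<Rightarrow> ('v, 's) igraph \<Rightarrow> ('v, 's) igraph" where
  "cap_degree d G = IGraph (verts G)
     (\<lambda>(x, y). if info_degree G x \<le> d \<and> info_degree G y \<le> d then info G (x, y) else None)"

lemma info_bounded_iff: "G \<in> Omega S \<Longrightarrow> info_bounded d G \<longleftrightarrow> (\<forall>v\<in>verts G. info_degree G v \<le> d)"
  by (simp add: info_bounded_def info_degree_def info_neighbours)

lemma verts_cap_degree [simp]: "verts (cap_degree d G) = verts G"
  by (simp add: cap_degree_def)

lemma info_cap_degree: "info (cap_degree d G) (x, y) =
    (if info_degree G x \<le> d \<and> info_degree G y \<le> d then info G (x, y) else None)"
  by (simp add: cap_degree_def)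

lemma info_adj_cap_degree: "info_adj (cap_degree d G) \<subseteq> info_adj G"
  by (auto simp: info_adj_def info_cap_degree split: if_splits)

lemma cap_degree_Omega: "G \<in> Omega S \<Longrightarrow> cap_degree d G \<in> Omega S"
  by (simp add: Omega_def info_cap_degree)

lemma info_bounded_cap_degree:
  assumes "G \<in> Omega S"
  shows "info_bounded d (cap_degree d G)"
  unfolding info_bounded_iff[OF cap_degree_Omega[OF assms]]
proof
  fix v assume "v \<in> verts (cap_degree d G)"
  have fin: "finite (info_adj G `` {v})"
    using info_adj_subset[OF assms] assms finite_subset[of "info_adj G `` {v}" "verts G"]
    by (auto simp: Omega_def)
  show "info_degree (cap_degree d G) v \<le> d"
  proof (cases "info_degree G v \<le> d")
    case True
    have "info_adj (cap_degree d G) `` {v} \<subseteq> info_adj G `` {v}" using info_adj_cap_degree by blast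
    then have "card (info_adj (cap_degree d G) `` {v}) \<le> card (info_adj G `` {v})"
      using fin by (rule card_mono[rotated])
    then show ?thesis using True by (auto simp: info_degree_def info_cap_degree)
  next
    case False
    then have "info (cap_degree d G) (v, x) = None" "info (cap_degree d G) (x, v) = None" for x
      by (simp_all add: info_cap_degree)
    then show ?thesis by (simp add: info_degree_def info_adj_def Image_def)
  qed
qed

lemma cap_degree_id:
  assumes "G \<in> Omega S" "info_bounded d G"
  shows "cap_degree d G = G"
proof -
  have "info (cap_degree d G) (x, y) = info G (x, y)" for x y
  proof (cases "x \<in> verts G \<and> y \<in> verts G")
    case True
    then show ?thesis using assms by (simp add: info_bounded_iff info_cap_degree)
  next
    case False
    then have "info G (x, y) = None" using assms(1) by (auto simp: Omega_def)
    then show ?thesis by (simp add: info_cap_degree)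
  qed
  then show ?thesis by (intro igraph.expand) auto
qed

text \<open>
  The scheme of the locality proofs: \<open>R\<close> is the adjacency of the original graph and \<open>Q\<close> that of
  the derived one.
\<close>

lemma rooted_iso_map_restrict:
  assumes "rooted_adj_iso_map \<phi> R x R' x' K"
    and "\<And>i y. i < k \<Longrightarrow> y \<in> ball Q x i \<Longrightarrow> Q' `` {\<phi> y} = \<phi> ` (Q `` {y})"
    and "ball Q x k \<subseteq> ball R x K"
    and "\<And>y z. y \<in> ball Q x k \<Longrightarrow> z \<in> ball Q x k \<Longrightarrow> l y z = l' (\<phi> y) (\<phi> z)"
  shows "rooted_iso_map \<phi> (ball Q x k) l x (ball Q' x' k) l' x'"
proof -
  have "inj_on \<phi> (ball R x K)" "\<phi> x = x'"
    using assms(1) unfolding rooted_iso_map_def bij_betw_def by auto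
  moreover have "\<phi> ` ball Q x k = ball Q' (\<phi> x) k" by (rule image_ball) (rule assms(2))
  ultimately show ?thesis
    unfolding rooted_iso_map_def bij_betw_def using assms(3,4) inj_on_subset by metis
qed

text \<open>
  Capping looks one step further than the disc itself, since the degree of a vertex on the
  boundary of the \<open>k\<close>-disc is seen in the \<open>Suc k\<close>-disc only.
\<close>

lemma cap_degree_local:
  assumes \<phi>: "rooted_info_iso_map \<phi> G v G' v' (Suc k)"
  shows "rooted_info_iso_map \<phi> (cap_degree d G) v (cap_degree d G') v' k"
proof -
  let ?R = "info_adj G" and ?R' = "info_adj G'"
  let ?Q = "info_adj (cap_degree d G)" and ?Q' = "info_adj (cap_degree d G')"
  note \<phi>_adj = rooted_info_iso_map_adj[OF \<phi>]
  have inj: "inj_on \<phi> (ball ?R v (Suc k))"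
    and info: "\<And>y z. y \<in> ball ?R v (Suc k) \<Longrightarrow> z \<in> ball ?R v (Suc k) \<Longrightarrow> info G (y, z) = info G' (\<phi> y, \<phi> z)"
    using \<phi> unfolding rooted_iso_map_def bij_betw_def by auto
  have sub: "ball ?R v k \<subseteq> ball ?R v (Suc k)" by (rule ball_mono) simp
  have nbs: "?R' `` {\<phi> y} = \<phi> ` (?R `` {y})" if "y \<in> ball ?R v k" for y
    using rooted_adj_iso_map_neighbours[OF \<phi>_adj that] by simp
  have deg: "info_degree G' (\<phi> y) = info_degree G y" if "y \<in> ball ?R v k" for y
  proof -
    have "?R `` {y} \<subseteq> ball ?R v (Suc k)" using that by auto
    then have "inj_on \<phi> (?R `` {y})" using inj inj_on_subset by blast
    then have "card (?R' `` {\<phi> y}) = card (?R `` {y})" using nbs[OF that] card_image by metis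
    then show ?thesis using info[of y y] that sub by (simp add: info_degree_def subset_iff)
  qed
  have info': "info (cap_degree d G) (y, z) = info (cap_degree d G') (\<phi> y, \<phi> z)"
    if "y \<in> ball ?R v k" "z \<in> ball ?R v k" for y z
    using that sub info[of y z] deg by (auto simp: info_cap_degree)
  have adj': "(\<phi> y, \<phi> z) \<in> ?Q' \<longleftrightarrow> (y, z) \<in> ?Q" if "y \<in> ball ?R v k" "z \<in> ball ?R v k" for y z
  proof -
    have "\<phi> y = \<phi> z \<longleftrightarrow> y = z" using inj that sub by (simp add: inj_on_eq_iff subset_iff)
    then show ?thesis using info'[OF that] info'[OF that(2,1)] by (simp add: info_adj_def)
  qed
  have "?Q \<subseteq> ?R" by (rule info_adj_cap_degree)
  then have Q: "ball ?Q v i \<subseteq> ball ?R v i" for i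
    by (induction i) auto
  show ?thesis
  proof (rule rooted_iso_map_restrict[OF \<phi>_adj])
    fix i y assume "i < k" "y \<in> ball ?Q v i"
    then have y: "y \<in> ball ?R v i" using Q by blast
    then have yk: "y \<in> ball ?R v k" using ball_mono[of i k ?R v] \<open>i < k\<close> by auto
    have nb: "z \<in> ball ?R v k" if "(y, z) \<in> ?R" for z using ball_step[OF y that] \<open>i < k\<close> by simp
    show "?Q' `` {\<phi> y} = \<phi> ` (?Q `` {y})"
    proof (intro set_eqI iffI)
      fix w assume "w \<in> ?Q' `` {\<phi> y}"
      then have w: "(\<phi> y, w) \<in> ?Q'" by simp
      then have "w \<in> ?R' `` {\<phi> y}" using info_adj_cap_degree by blast
      then obtain z where z: "(y, z) \<in> ?R" "w = \<phi> z" using nbs[OF yk] by auto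
      then show "w \<in> \<phi> ` (?Q `` {y})" using w adj'[OF yk nb[OF z(1)]] by blast
    next
      fix w assume "w \<in> \<phi> ` (?Q `` {y})"
      then obtain z where z: "(y, z) \<in> ?Q" "w = \<phi> z" by blast
      then have "(y, z) \<in> ?R" using info_adj_cap_degree by blast
      then show "w \<in> ?Q' `` {\<phi> y}" using z adj'[OF yk nb] by blast
    qed
  next
    show "ball ?Q v k \<subseteq> ball ?R v (Suc k)" using Q sub by blast
    show "info (cap_degree d G) (y, z) = info (cap_degree d G') (\<phi> y, \<phi> z)"
      if "y \<in> ball ?Q v k" "z \<in> ball ?Q v k" for y z
      using that Q by (intro info') blast+
  qed
qed


section \<open>Decoding simple graphs\<close>

definition degree :: "'v sgraph \<Rightarrow> 'v \<Rightarrow> nat" where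
  "degree H x = card (simple_adj H `` {x})"

text \<open>
  The labels \<open>s\<close> for which there is a path from \<open>x\<close> over an out-port of label \<open>s\<close> and an in-port
  to \<open>y\<close>.  The ports are recognised by their degrees, with \<open>ix s\<close> the offset that stands for \<open>s\<close>.
\<close>

definition path_labels :: "'s set \<Rightarrow> ('s \<Rightarrow> nat) \<Rightarrow> nat \<Rightarrow> 'v sgraph \<Rightarrow> 'v \<Rightarrow> 'v \<Rightarrow> 's set" where
  "path_labels S ix b H x y = {s \<in> S. \<exists>a c. (x, a) \<in> simple_adj H \<and> (a, c) \<in> simple_adj H \<and>
     (c, y) \<in> simple_adj H \<and> degree H a = b + ix s \<and> degree H c = b + 1}"

text \<open>
  A pair receives a label only if the paths agree on it, so that the result is well defined
  for every simple graph.
\<close>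

definition decode_raw :: "'s set \<Rightarrow> ('s \<Rightarrow> nat) \<Rightarrow> nat \<Rightarrow> 'v sgraph \<Rightarrow> ('v, 's) igraph" where
  "decode_raw S ix b H = IGraph {x \<in> nodes H. degree H x = b}
     (\<lambda>(x, y). if x \<in> nodes H \<and> y \<in> nodes H \<and> degree H x = b \<and> degree H y = b \<and>
         is_singleton (path_labels S ix b H x y)
       then Some (the_elem (path_labels S ix b H x y)) else None)"

lemma verts_decode_raw [simp]: "verts (decode_raw S ix b H) = {x \<in> nodes H. degree H x = b}"
  by (simp add: decode_raw_def)

lemma decode_raw_Omega: "simple_graph H \<Longrightarrow> decode_raw S ix b H \<in> Omega S"
proof -
  assume "simple_graph H"
  then have "finite (nodes H)" by (simp add: simple_graph_def)
  moreover have "the_elem L \<in> S" if "is_singleton L" "L \<subseteq> S" for L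
    using that by (auto simp: is_singleton_def)
  moreover have "path_labels S ix b H x y \<subseteq> S" for x y by (auto simp: path_labels_def)
  ultimately show ?thesis by (auto simp: Omega_def decode_raw_def)
qed

lemma ball_decode_raw_step:
  assumes "(x, y) \<in> info_adj (decode_raw S ix b H)" "x \<in> ball (simple_adj H) v j"
  shows "y \<in> ball (simple_adj H) v (j + 3)"
proof -
  have "is_singleton (path_labels S ix b H x y) \<or> is_singleton (path_labels S ix b H y x)"
    using assms(1) by (auto simp: info_adj_def decode_raw_def split: if_splits)
  then obtain s where "s \<in> path_labels S ix b H x y \<or> s \<in> path_labels S ix b H y x"
    by (auto elim!: is_singletonE)
  then obtain a c where path: "(x, a) \<in> simple_adj H" "(a, c) \<in> simple_adj H" "(c, y) \<in> simple_adj H"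
    unfolding path_labels_def by (auto dest: sym_simple_adj)
  have "c \<in> ball (simple_adj H) v (Suc (Suc j))"
    by (intro ball_step[OF ball_step[OF assms(2) path(1) order_refl] path(2) order_refl])
  then show ?thesis by (rule ball_step[OF _ path(3)]) simp
qed

lemma degree_transfer:
  assumes "inj_on \<phi> W" "simple_adj H `` {x} \<subseteq> W" "simple_adj H' `` {\<phi> x} = \<phi> ` (simple_adj H `` {x})"
  shows "degree H' (\<phi> x) = degree H x"
  unfolding degree_def assms(3) using assms(1,2) by (intro card_image) (rule inj_on_subset)

text \<open>
  The set \<open>P\<close> contains the first three vertices of every path of length three from \<open>y\<close>.  If \<open>\<phi>\<close>
  maps the neighbourhoods of these vertices onto those of their images, such paths can
  be moved in both directions; injectivity on \<open>W\<close> makes the last vertex come back to \<open>z\<close>.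
  The lemma serves partial isomorphisms of discs as well as the renaming of a whole graph.
\<close>

lemma path_labels_transfer:
  assumes inj: "inj_on \<phi> W" and z: "z \<in> W" and P: "y \<in> P" "simple_adj H `` {y} \<subseteq> P"
      "\<And>a. (y, a) \<in> simple_adj H \<Longrightarrow> simple_adj H `` {a} \<subseteq> P"
    and W: "\<And>x. x \<in> P \<Longrightarrow> simple_adj H `` {x} \<subseteq> W"
    and nbs: "\<And>x. x \<in> P \<Longrightarrow> simple_adj H' `` {\<phi> x} = \<phi> ` (simple_adj H `` {x})"
  shows "path_labels S ix b H' (\<phi> y) (\<phi> z) = path_labels S ix b H y z"
proof -
  let ?R = "simple_adj H" and ?R' = "simple_adj H'"
  have deg: "degree H' (\<phi> x) = degree H x" if "x \<in> P" for x
    using degree_transfer[OF inj W nbs] that by blast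
  have "(\<exists>a c. (\<phi> y, a) \<in> ?R' \<and> (a, c) \<in> ?R' \<and> (c, \<phi> z) \<in> ?R' \<and> degree H' a = p \<and> degree H' c = q)
    \<longleftrightarrow> (\<exists>a c. (y, a) \<in> ?R \<and> (a, c) \<in> ?R \<and> (c, z) \<in> ?R \<and> degree H a = p \<and> degree H c = q)"
    (is "?L \<longleftrightarrow> ?L'") for p q
  proof
    assume ?L
    then obtain a' c' where *: "(\<phi> y, a') \<in> ?R'" "(a', c') \<in> ?R'" "(c', \<phi> z) \<in> ?R'"
      "degree H' a' = p" "degree H' c' = q" by blast
    from *(1) obtain a where a: "(y, a) \<in> ?R" "a' = \<phi> a" using nbs[OF P(1)] by auto
    then have aP: "a \<in> P" using P(2) by auto
    from *(2) obtain c where c: "(a, c) \<in> ?R" "c' = \<phi> c" using nbs[OF aP] a by auto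
    then have cP: "c \<in> P" using P(3) a by auto
    from *(3) obtain z' where z': "(c, z') \<in> ?R" "\<phi> z = \<phi> z'" using nbs[OF cP] c by auto
    then have "z' \<in> W" using W[OF cP] by auto
    then have "z' = z" using z' z inj by (metis inj_on_eq_iff)
    moreover have "degree H a = p" "degree H c = q" using *(4,5) a(2) c(2) deg aP cP by simp_all
    ultimately show ?L' using a(1) c(1) z'(1) by blast
  next
    assume ?L'
    then obtain a c where *: "(y, a) \<in> ?R" "(a, c) \<in> ?R" "(c, z) \<in> ?R"
      "degree H a = p" "degree H c = q" by blast
    have aP: "a \<in> P" and cP: "c \<in> P" using P * by auto
    have "\<phi> a \<in> ?R' `` {\<phi> y}" using nbs[OF P(1)] * by auto
    moreover have "\<phi> c \<in> ?R' `` {\<phi> a}" using nbs[OF aP] * by auto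
    moreover have "\<phi> z \<in> ?R' `` {\<phi> c}" using nbs[OF cP] * by auto
    moreover have "degree H' (\<phi> a) = p" "degree H' (\<phi> c) = q" using *(4,5) deg aP cP by simp_all
    ultimately show ?L by blast
  qed
  then show ?thesis unfolding path_labels_def by simp
qed

text \<open>
  A step in the decoded graph is at most three steps in \<open>H\<close>, which explains \<open>3 * k\<close>.  The
  remaining \<open>7\<close> splits into \<open>3\<close>, because an arc can start at the other end of a decoded edge,
  and \<open>4\<close>, which suffices to see a path of length three together with the degrees of
  its vertices.
\<close>

lemma decode_raw_local:
  assumes \<phi>: "rooted_adj_iso_map \<phi> (simple_adj H) v (simple_adj H') v' K" and K: "3 * k + 7 \<le> K"
    and H: "simple_graph H" "v \<in> nodes H" "simple_graph H'" "v' \<in> nodes H'"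
  shows "degree H' v' = degree H v"
    and "rooted_info_iso_map \<phi> (decode_raw S ix b H) v (decode_raw S ix b H') v' k"
proof -
  let ?R = "simple_adj H" and ?R' = "simple_adj H'"
  let ?F = "decode_raw S ix b H" and ?F' = "decode_raw S ix b H'"
  let ?Q = "info_adj ?F" and ?Q' = "info_adj ?F'"
  have inj: "inj_on \<phi> (ball ?R v K)" and root: "\<phi> v = v'"
    using \<phi> unfolding rooted_iso_map_def bij_betw_def by auto
  have nbs: "?R' `` {\<phi> y} = \<phi> ` (?R `` {y})" if "y \<in> ball ?R v j" "j < K" for y j
    using rooted_adj_iso_map_neighbours[OF \<phi> that] .
  have im: "\<phi> ` ball ?R v j = ball ?R' v' j" if "j \<le> K" for j
    using rooted_adj_iso_map_image_ball[OF \<phi> that] .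
  have mono: "y \<in> ball ?R v i \<Longrightarrow> i \<le> j \<Longrightarrow> y \<in> ball ?R v j" for y i j
    using ball_mono[of i j ?R v] by auto
  have deg: "degree H' (\<phi> y) = degree H y" if "y \<in> ball ?R v j" "j < K" for y j
  proof -
    have "?R `` {y} \<subseteq> ball ?R v K" using that ball_step[of y ?R v j _ K] by auto
    then show ?thesis by (rule degree_transfer[OF inj _ nbs[OF that]])
  qed
  show "degree H' v' = degree H v" using deg[of v 0] root K by simp
  have node: "y \<in> nodes H" "\<phi> y \<in> nodes H'" if "y \<in> ball ?R v j" "j \<le> K" for y j
    using that im[of j] ball_subset[OF H(2) simple_adj_subset[OF H(1)], of j]
      ball_subset[OF H(4) simple_adj_subset[OF H(3)], of j] by auto
  have labels: "path_labels S ix b H' (\<phi> y) (\<phi> z) = path_labels S ix b H y z"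
    if y: "y \<in> ball ?R v j" "j + 4 \<le> K" and z: "z \<in> ball ?R v K" for y z j
  proof (rule path_labels_transfer[OF inj z])
    show "y \<in> ball ?R v (j + 2)" "?R `` {y} \<subseteq> ball ?R v (j + 2)"
      "\<And>a. (y, a) \<in> ?R \<Longrightarrow> ?R `` {a} \<subseteq> ball ?R v (j + 2)"
      using y(1) by (auto simp: numeral_2_eq_2)
    show "?R `` {x} \<subseteq> ball ?R v K" if "x \<in> ball ?R v (j + 2)" for x
      using ball_step[OF that, of _ K] y(2) by auto
    show "?R' `` {\<phi> x} = \<phi> ` (?R `` {x})" if "x \<in> ball ?R v (j + 2)" for x
      using nbs[OF that] y(2) by simp
  qed
  have info: "info ?F (y, z) = info ?F' (\<phi> y, \<phi> z)"
    if "y \<in> ball ?R v j" "j + 4 \<le> K" "z \<in> ball ?R v i" "i < K" for y z i j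
  proof -
    have "z \<in> ball ?R v K" using that mono by (metis less_imp_le)
    then show ?thesis
      using that node[of y j] node[of z i] deg[of y j] deg[of z i] labels[of y j z]
      by (simp add: decode_raw_def)
  qed
  have adj: "(\<phi> y, \<phi> z) \<in> ?Q' \<longleftrightarrow> (y, z) \<in> ?Q"
    if "y \<in> ball ?R v j" "z \<in> ball ?R v j" "j + 4 \<le> K" for y z j
  proof -
    have "\<phi> y = \<phi> z \<longleftrightarrow> y = z" using inj that mono[of _ j K] by (simp add: inj_on_eq_iff)
    moreover have "j < K" using that by simp
    ultimately show ?thesis
      using info[OF that(1,3,2)] info[OF that(2,3,1)] by (simp add: info_adj_def)
  qed
  have Q: "ball ?Q v i \<subseteq> ball ?R v (3 * i)" for i
  proof (induction i)
    case (Suc i)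
    then show ?case using ball_decode_raw_step[of _ _ S ix b H v "3 * i"] mono[of _ "3 * i" "3 * i + 3"]
      by (auto simp: add.commute)
  qed simp
  show "rooted_info_iso_map \<phi> ?F v ?F' v' k"
  proof (rule rooted_iso_map_restrict[OF \<phi>])
    fix i y assume i: "i < k" and "y \<in> ball ?Q v i"
    then have y: "y \<in> ball ?R v (3 * i)" using Q by blast
    then have y3: "y \<in> ball ?R v (3 * i + 3)" by (rule mono) simp
    have y': "\<phi> y \<in> ball ?R' v' (3 * i)" using im[of "3 * i"] y i K by auto
    have le: "3 * i + 3 + 4 \<le> K" using i K by simp
    show "?Q' `` {\<phi> y} = \<phi> ` (?Q `` {y})"
    proof (intro set_eqI iffI)
      fix w assume "w \<in> ?Q' `` {\<phi> y}"
      then have w: "(\<phi> y, w) \<in> ?Q'" by simp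
      then have "w \<in> ball ?R' v' (3 * i + 3)" using ball_decode_raw_step y' by metis
      then obtain z where "w = \<phi> z" "z \<in> ball ?R v (3 * i + 3)" using im[of "3 * i + 3"] le by auto
      then show "w \<in> \<phi> ` (?Q `` {y})" using w adj[OF y3 _ le] by blast
    next
      fix w assume "w \<in> \<phi> ` (?Q `` {y})"
      then obtain z where z: "(y, z) \<in> ?Q" "w = \<phi> z" by blast
      then have "z \<in> ball ?R v (3 * i + 3)" using ball_decode_raw_step y by metis
      then show "w \<in> ?Q' `` {\<phi> y}" using z adj[OF y3 _ le] by blast
    qed
  next
    have "ball ?R v (3 * k) \<subseteq> ball ?R v K" using K by (intro ball_mono) simp
    then show "ball ?Q v k \<subseteq> ball ?R v K" using Q by blast
    show "info ?F (y, z) = info ?F' (\<phi> y, \<phi> z)" if "y \<in> ball ?Q v k" "z \<in> ball ?Q v k" for y z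
      using that Q K by (intro info[of y "3 * k" z "3 * k"]) auto
  qed
qed

definition decode :: "'s set \<Rightarrow> ('s \<Rightarrow> nat) \<Rightarrow> nat \<Rightarrow> nat \<Rightarrow> 'v sgraph \<Rightarrow> ('v, 's) igraph" where
  "decode S ix b d H = cap_degree d (decode_raw S ix b H)"

lemma verts_decode: "verts (decode S ix b d H) = {x \<in> nodes H. degree H x = b}"
  by (simp add: decode_def)

lemma decode_Omega: "simple_graph H \<Longrightarrow> decode S ix b d H \<in> Omega S"
  by (simp add: decode_def decode_raw_Omega cap_degree_Omega)

lemma info_bounded_decode: "simple_graph H \<Longrightarrow> info_bounded d (decode S ix b d H)"
  unfolding decode_def using decode_raw_Omega by (rule info_bounded_cap_degree)

text \<open>
  The radius is \<open>3 * Suc k + 7\<close>: capping the degrees needs the \<open>Suc k\<close>-disc of the raw decoding.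
\<close>

lemma decode_disc_iso:
  assumes H: "simple_graph H" "v \<in> nodes H" "simple_graph H'" "v' \<in> nodes H'"
    and iso: "simple_rooted_iso (simple_disc (3 * k + 10) H v) (simple_disc (3 * k + 10) H' v')"
    and v: "v \<in> verts (decode S ix b d H)"
  shows "v' \<in> verts (decode S ix b d H')"
    and "info_rooted_iso (info_disc k (decode S ix b d H) v) (info_disc k (decode S ix b d H') v')"
proof -
  obtain \<phi> where \<phi>: "rooted_adj_iso_map \<phi> (simple_adj H) v (simple_adj H') v' (3 * k + 10)"
    using iso unfolding simple_rooted_iso_disc_iff[OF H] ..
  have "3 * Suc k + 7 \<le> 3 * k + 10" by simp
  note loc = decode_raw_local[OF \<phi> this H]
  show v': "v' \<in> verts (decode S ix b d H')" using loc(1) v H(4) by (simp add: verts_decode)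
  show "info_rooted_iso (info_disc k (decode S ix b d H) v) (info_disc k (decode S ix b d H') v')"
    unfolding info_rooted_iso_disc_iff[OF decode_Omega[OF H(1)] v decode_Omega[OF H(3)] v']
    using cap_degree_local[OF loc(2)] unfolding decode_def by blast
qed

lemma decode_freq_dist:
  fixes H H' :: "'v sgraph" and S :: "'s set" and ix :: "'s \<Rightarrow> nat" and b d d' k :: nat
  assumes S: "finite S" and H: "simple_graph H" "simple_bounded d' H"
    and H': "simple_graph H'" "simple_bounded d' H'"
  defines "F \<equiv> decode S ix b d"
  defines "\<mu> \<equiv> \<lambda>H :: 'v sgraph. real (card (verts (F H))) / real (card (nodes H))"
    and "\<delta> \<equiv> simple_freq_dist d' (3 * k + 10) H H'"
  shows "\<bar>\<mu> H - \<mu> H'\<bar> \<le> \<delta>"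
    and "verts (F H) \<noteq> {} \<Longrightarrow> verts (F H') \<noteq> {} \<Longrightarrow> info_freq_dist S d k (F H) (F H') * \<mu> H \<le> \<delta> + \<bar>\<mu> H - \<mu> H'\<bar>"
proof -
  let ?I = "{H :: 'v sgraph. simple_graph H \<and> simple_bounded d' H}"
  let ?K = "3 * k + 10"
  have fin: "finite (nodes H)" if "H \<in> ?I" for H using that by (simp add: simple_graph_def)
  have type: "\<exists>!\<Gamma>. \<Gamma> \<in> simple_disc_types d' ?K \<and> simple_disc ?K H v \<in> \<Gamma>" if "H \<in> ?I" "v \<in> nodes H" for H v
    by (rule simple_disc_type_ex1) (use that in auto)
  have sub: "verts (F H) \<subseteq> nodes H" for H by (auto simp: F_def verts_decode)
  have F: "F H \<in> Omega S" "info_bounded d (F H)" if "H \<in> ?I" for H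
    using that by (auto simp: F_def decode_Omega info_bounded_decode)
  have type': "\<exists>!\<Gamma>. \<Gamma> \<in> info_disc_types S d k \<and> info_disc k (F H) v \<in> \<Gamma>"
    if "H \<in> ?I" "v \<in> verts (F H)" for H v
    by (rule info_disc_type_ex1[OF F[OF that(1)] that(2)])
  have satM: "v' \<in> verts (F H')"
    if "H \<in> ?I" "H' \<in> ?I" "\<Gamma> \<in> simple_disc_types d' ?K" "v \<in> verts (F H)" "v' \<in> nodes H'"
      "simple_disc ?K H v \<in> \<Gamma>" "simple_disc ?K H' v' \<in> \<Gamma>" for H H' \<Gamma> v v'
    unfolding F_def
    by (rule decode_disc_iso(1)[OF _ _ _ _ simple_disc_type_iso[OF that(3,6,7)]])
      (use that sub in \<open>auto simp: F_def\<close>)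
  have satD: "info_disc k (F H') v' \<in> \<Gamma>'"
    if "H \<in> ?I" "H' \<in> ?I" "\<Gamma> \<in> simple_disc_types d' ?K" "v \<in> verts (F H)" "v' \<in> verts (F H')"
      "simple_disc ?K H v \<in> \<Gamma>" "simple_disc ?K H' v' \<in> \<Gamma>" "\<Gamma>' \<in> info_disc_types S d k"
      "info_disc k (F H) v \<in> \<Gamma>'" for H H' \<Gamma> \<Gamma>' v v'
    using that(8,9)
  proof (rule info_disc_type_closed)
    show "info_rooted_iso (info_disc k (F H) v) (info_disc k (F H') v')"
      unfolding F_def
      by (rule decode_disc_iso(2)[OF _ _ _ _ simple_disc_type_iso[OF that(3,6,7)]])
        (use that sub in \<open>auto simp: F_def\<close>)
    show "info_disc k (F H') v' \<in> info_discs S d k" using F[OF that(2)] that(5) by (rule info_disc_in_discs)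
  qed
  have I: "H \<in> ?I" "H' \<in> ?I" using assms by auto
  note dist = l1_dist_frequency_transfer[where I = ?I and M = "\<lambda>H. verts (F H)" and V = nodes
        and D = "simple_disc ?K" and D' = "\<lambda>H. info_disc k (F H)",
      OF finite_simple_disc_types finite_info_disc_types[OF S] fin type sub type' satM satD I]
  show "\<bar>\<mu> H - \<mu> H'\<bar> \<le> \<delta>"
    unfolding \<mu>_def \<delta>_def simple_freq_dist_def simple_freq_def[abs_def]
    by (rule dist(1))
  show "info_freq_dist S d k (F H) (F H') * \<mu> H \<le> \<delta> + \<bar>\<mu> H - \<mu> H'\<bar>"
    if "verts (F H) \<noteq> {}" "verts (F H') \<noteq> {}"
    unfolding \<mu>_def \<delta>_def simple_freq_dist_def simple_freq_def[abs_def]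
      info_freq_dist_def info_freq_def[abs_def]
    by (rule dist(2)) (assumption | rule that)+
qed


section \<open>Encoding \<open>S\<close>-graphs\<close>

text \<open>
  Vertices of clusters are pairs \<open>(u, i)\<close> with a role \<open>i\<close>: \<open>0\<close> for the centre, \<open>1\<close> for the in-port,
  and \<open>ix s\<close> for the out-port of label \<open>s\<close>.  The relation \<open>core_arc\<close> lists each edge between
  such vertices in one direction, from centre to port or from out-port to in-port.
\<close>

definition core_arc :: "'s set \<Rightarrow> ('s \<Rightarrow> nat) \<Rightarrow> ('v, 's) igraph \<Rightarrow> 'v \<times> nat \<Rightarrow> 'v \<times> nat \<Rightarrow> bool" where
  "core_arc S ix G p q \<longleftrightarrow> snd p = 0 \<and> snd q \<noteq> 0 \<and> fst p = fst q \<or>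
     (\<exists>s\<in>S. snd p = ix s \<and> snd q = 1 \<and> info G (fst p, fst q) = Some s)"

definition core :: "'s set \<Rightarrow> ('v, 's) igraph \<Rightarrow> ('v \<times> nat) set" where
  "core S G = verts G \<times> {..<card S + 2}"

definition core_nbrs :: "'s set \<Rightarrow> ('s \<Rightarrow> nat) \<Rightarrow> ('v, 's) igraph \<Rightarrow> 'v \<times> nat \<Rightarrow> ('v \<times> nat) set" where
  "core_nbrs S ix G p = {q \<in> core S G. core_arc S ix G p q \<or> core_arc S ix G q p}"

definition padding :: "'s set \<Rightarrow> ('s \<Rightarrow> nat) \<Rightarrow> nat \<Rightarrow> ('v, 's) igraph \<Rightarrow> 'v \<times> nat \<Rightarrow> nat" where
  "padding S ix b G p = b + snd p - card (core_nbrs S ix G p)"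

text \<open>
  The node \<open>(p, 0)\<close> is the cluster vertex \<open>p\<close>, and \<open>(p, n)\<close> with \<open>n \<noteq> 0\<close> is one of its leaves.
\<close>

definition encode :: "'s set \<Rightarrow> ('s \<Rightarrow> nat) \<Rightarrow> nat \<Rightarrow> ('v, 's) igraph \<Rightarrow> (('v \<times> nat) \<times> nat) sgraph" where
  "encode S ix b G = SGraph (SIGMA p:core S G. {..padding S ix b G p})
     ({{(p, 0), (q, 0)} | p q. p \<in> core S G \<and> q \<in> core_nbrs S ix G p} \<union>
      {{(p, 0), (p, n)} | p n. p \<in> core S G \<and> n \<noteq> 0 \<and> n \<le> padding S ix b G p})"

locale encoding =
  fixes S :: "'s set" and ix :: "'s \<Rightarrow> nat" and d b :: nat and G :: "('v, 's) igraph"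
  assumes finite_S: "finite S" and inj_ix: "inj_on ix S" and ix: "s \<in> S \<Longrightarrow> 2 \<le> ix s \<and> ix s < card S + 2"
    and G: "G \<in> Omega S" "info_bounded d G" and b: "b = d + card S + 2"
begin

abbreviation "E \<equiv> encode S ix b G"

lemma finite_verts: "finite (verts G)"
  using G by (simp add: Omega_def)

lemma finite_core: "finite (core S G)"
  using finite_verts by (simp add: core_def)

lemma info_in: "info G (u, v) = Some s \<Longrightarrow> u \<in> verts G \<and> v \<in> verts G \<and> s \<in> S"
  using Omega_info_Some[OF G(1)] by simp

lemma ix_ne: "s \<in> S \<Longrightarrow> ix s \<noteq> 0" "s \<in> S \<Longrightarrow> 0 \<noteq> ix s" "s \<in> S \<Longrightarrow> ix s \<noteq> Suc 0" "s \<in> S \<Longrightarrow> Suc 0 \<noteq> ix s"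
  using ix[of s] by auto

lemma not_core_arc_refl: "\<not> core_arc S ix G p p"
  unfolding core_arc_def using ix_ne by force

lemma core_nbrs_sym: "p \<in> core S G \<Longrightarrow> q \<in> core_nbrs S ix G p \<Longrightarrow> p \<in> core_nbrs S ix G q"
  by (auto simp: core_nbrs_def)

text \<open>
  The neighbours of a cluster vertex lie in its own cluster, of size \<open>card S + 2\<close>, or belong to
  one of the at most \<open>d\<close> vertices joined to \<open>u\<close> by an arc or a loop, each of which contributes at
  most one.  Consequently the truncated subtraction in \<open>padding\<close> is a true one.
\<close>

lemma card_core_nbrs:
  assumes p: "p \<in> core S G"
  shows "card (core_nbrs S ix G p) \<le> b"
proof -
  obtain u i where pi: "p = (u, i)" by fastforce
  with p have u: "u \<in> verts G" by (simp add: core_def)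
  \<comment> \<open>The only possible neighbour of \<open>p\<close> in the cluster of another vertex \<open>w\<close> is \<open>h w\<close>.\<close>
  define N where "N = {w. info G (u, w) \<noteq> None \<or> info G (w, u) \<noteq> None}"
  define h where "h w = (w, if i = 1 then ix (the (info G (w, u))) else 1)" for w
  have fin_adj: "finite (info_adj G `` {u})"
    using info_adj_subset[OF G(1)] finite_verts finite_subset[of "info_adj G `` {u}" "verts G"] by blast
  have "N = info_adj G `` {u} \<union> (if info G (u, u) \<noteq> None then {u} else {})"
    by (auto simp: N_def info_adj_def)
  then have finN: "finite N" and N': "card N \<le> card (info_adj G `` {u}) + (if info G (u, u) \<noteq> None then 1 else 0)"
    using fin_adj card_Un_le[of "info_adj G `` {u}" "{u}"] by auto
  note N'
  also have "\<dots> \<le> info_degree G u" by (simp add: info_degree_def)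
  also have "\<dots> \<le> d" using G(2) u by (simp add: info_bounded_iff[OF G(1)])
  finally have N: "card N \<le> d" .
  have "core_nbrs S ix G p \<subseteq> {u} \<times> {..<card S + 2} \<union> h ` N"
  proof
    fix q assume "q \<in> core_nbrs S ix G p"
    then obtain w j where q: "q = (w, j)" "j < card S + 2" "core_arc S ix G p q \<or> core_arc S ix G q p"
      by (cases q) (auto simp: core_nbrs_def core_def)
    then consider "u = w" | s where "s \<in> S" "i = ix s" "j = 1" "info G (u, w) = Some s"
      | s where "s \<in> S" "j = ix s" "i = 1" "info G (w, u) = Some s"
      unfolding core_arc_def pi by auto
    then show "q \<in> {u} \<times> {..<card S + 2} \<union> h ` N"
    proof cases
      case 1
      then show ?thesis using q by simp
    next
      case 2
      then have "i \<noteq> 1" using ix[of s] by auto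
      then have "h w = q" using 2 q by (simp add: h_def)
      moreover have "w \<in> N" using 2 by (simp add: N_def)
      ultimately show ?thesis by blast
    next
      case 3
      then have "h w = q" using q by (simp add: h_def)
      moreover have "w \<in> N" using 3 by (simp add: N_def)
      ultimately show ?thesis by blast
    qed
  qed
  then have "card (core_nbrs S ix G p) \<le> card ({u} \<times> {..<card S + 2} \<union> h ` N)"
    using finN by (intro card_mono) auto
  also have "\<dots> \<le> card ({u} \<times> {..<card S + 2}) + card (h ` N)" by (rule card_Un_le)
  also have "\<dots> \<le> card S + 2 + d" using card_image_le[OF finN, of h] N by simp
  finally show ?thesis by (simp add: b)
qed

lemma nodes_encode: "nodes E = (SIGMA p:core S G. {..padding S ix b G p})"
  by (simp add: encode_def)

lemma edges_encode_iff: "e \<in> edges E \<longleftrightarrow>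
    (\<exists>p q. e = {(p, 0), (q, 0)} \<and> p \<in> core S G \<and> q \<in> core_nbrs S ix G p) \<or>
    (\<exists>p n. e = {(p, 0), (p, n)} \<and> p \<in> core S G \<and> n \<noteq> 0 \<and> n \<le> padding S ix b G p)"
  unfolding encode_def sgraph.sel by blast

lemma adj_core:
  assumes p: "p \<in> core S G"
  shows "simple_adj E `` {(p, 0)} =
    (\<lambda>q. (q, 0)) ` core_nbrs S ix G p \<union> Pair p ` {1..padding S ix b G p}"
proof (intro set_eqI iffI)
  fix y assume "y \<in> simple_adj E `` {(p, 0)}"
  then have "{(p, 0), y} \<in> edges E" by (simp add: simple_adj_def)
  then consider p' q where "{(p, 0), y} = {(p', 0), (q, 0)}" "p' \<in> core S G" "q \<in> core_nbrs S ix G p'"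
    | p' n where "{(p, 0), y} = {(p', 0), (p', n)}" "n \<noteq> 0" "n \<le> padding S ix b G p'"
    unfolding edges_encode_iff by blast
  then show "y \<in> (\<lambda>q. (q, 0)) ` core_nbrs S ix G p \<union> Pair p ` {1..padding S ix b G p}"
  proof cases
    case 1
    then show ?thesis using core_nbrs_sym[of p' q] by (auto simp: doubleton_eq_iff)
  next
    case 2
    then show ?thesis by (auto simp: doubleton_eq_iff)
  qed
next
  fix y assume "y \<in> (\<lambda>q. (q, 0)) ` core_nbrs S ix G p \<union> Pair p ` {1..padding S ix b G p}"
  then consider q where "y = (q, 0)" "q \<in> core_nbrs S ix G p"
    | n where "y = (p, n)" "n \<noteq> 0" "n \<le> padding S ix b G p" by auto
  then have "{(p, 0), y} \<in> edges E"
    unfolding edges_encode_iff using p by cases blast+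
  then show "y \<in> simple_adj E `` {(p, 0)}" by (simp add: simple_adj_def)
qed

lemma adj_core_iff:
  assumes "p \<in> core S G"
  shows "((p, 0), (q, 0)) \<in> simple_adj E \<longleftrightarrow> q \<in> core_nbrs S ix G p"
proof -
  have "((p, 0), (q, 0)) \<in> simple_adj E \<longleftrightarrow> (q, 0) \<in> simple_adj E `` {(p, 0)}" by simp
  also have "\<dots> \<longleftrightarrow> q \<in> core_nbrs S ix G p" unfolding adj_core[OF assms] by auto
  finally show ?thesis .
qed

lemma adj_leaf:
  assumes n: "n \<noteq> 0" and p: "(p, n) \<in> nodes E"
  shows "simple_adj E `` {(p, n)} = {(p, 0)}"
proof (intro set_eqI iffI)
  fix y assume "y \<in> simple_adj E `` {(p, n)}"
  then have "{(p, n), y} \<in> edges E" by (simp add: simple_adj_def)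
  then show "y \<in> {(p, 0)}" using n unfolding edges_encode_iff by (auto simp: doubleton_eq_iff)
next
  fix y assume "y \<in> {(p, 0 :: nat)}"
  moreover have "p \<in> core S G" "n \<le> padding S ix b G p" using p by (auto simp: nodes_encode)
  ultimately have "{y, (p, n)} \<in> edges E" using n unfolding edges_encode_iff by blast
  then show "y \<in> simple_adj E `` {(p, n)}" by (simp add: simple_adj_def insert_commute)
qed

lemma degree_core:
  assumes p: "p \<in> core S G"
  shows "degree E (p, 0) = b + snd p"
proof -
  let ?A = "(\<lambda>q. (q, 0 :: nat)) ` core_nbrs S ix G p" and ?B = "Pair p ` {1..padding S ix b G p}"
  have "finite (core_nbrs S ix G p)" using finite_core by (simp add: core_nbrs_def)
  then have "card (?A \<union> ?B) = card ?A + card ?B" by (intro card_Un_disjoint) auto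
  also have "card ?A = card (core_nbrs S ix G p)" by (intro card_image) (simp add: inj_on_def)
  also have "card ?B = padding S ix b G p" by (subst card_image) (simp_all add: inj_on_def)
  finally show ?thesis
    unfolding degree_def adj_core[OF p] using card_core_nbrs[OF p] by (simp add: padding_def)
qed

lemma degree_leaf: "n \<noteq> 0 \<Longrightarrow> (p, n) \<in> nodes E \<Longrightarrow> degree E (p, n) = 1"
  by (simp add: degree_def adj_leaf)

text \<open>
  Leaves have degree \<open>1\<close>, which is less than \<open>b\<close>, and thus cannot be mistaken for a cluster vertex.
\<close>

lemma degree_encode:
  assumes "x \<in> nodes E" "i < card S + 2"
  shows "degree E x = b + i \<longleftrightarrow> (\<exists>u\<in>verts G. x = ((u, i), 0))"
proof -
  obtain u j n where x: "x = ((u, j), n)" by (metis surj_pair)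
  then have uj: "(u, j) \<in> core S G" using assms(1) by (auto simp: nodes_encode)
  then have "u \<in> verts G" by (simp add: core_def)
  show ?thesis
  proof (cases "n = 0")
    case True
    then show ?thesis using degree_core[OF uj] x \<open>u \<in> verts G\<close> by auto
  next
    case False
    then show ?thesis using degree_leaf assms(1) x by (simp add: b)
  qed
qed

lemma simple_graph_encode: "simple_graph E"
proof -
  have "finite (nodes E)" unfolding nodes_encode using finite_core by (intro finite_SigmaI) auto
  moreover have "e \<subseteq> nodes E \<and> card e = 2" if e: "e \<in> edges E" for e
  proof -
    consider p q where "e = {(p, 0), (q, 0)}" "p \<in> core S G" "q \<in> core_nbrs S ix G p"
      | p n where "e = {(p, 0), (p, n)}" "p \<in> core S G" "n \<noteq> 0" "n \<le> padding S ix b G p"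
      using e unfolding edges_encode_iff by blast
    then show ?thesis
    proof cases
      case 1
      then have "p \<noteq> q" "q \<in> core S G" using not_core_arc_refl[of p] by (auto simp: core_nbrs_def)
      then show ?thesis using 1 by (auto simp: nodes_encode card_2_iff)
    next
      case 2
      then show ?thesis by (auto simp: nodes_encode card_2_iff)
    qed
  qed
  ultimately show ?thesis by (simp add: simple_graph_def)
qed

lemma simple_bounded_encode: "simple_bounded (d + 2 * card S + 3) E"
  unfolding simple_bounded_iff[OF simple_graph_encode]
proof
  fix x assume x: "x \<in> nodes E"
  obtain p n where pn: "x = (p, n)" by fastforce
  then have p: "p \<in> core S G" using x by (auto simp: nodes_encode)
  then have "snd p < card S + 2" by (auto simp: core_def)
  then have "degree E x \<le> d + 2 * card S + 3"
    using degree_core[OF p] degree_leaf[of n p] pn x by (cases "n = 0") (simp_all add: b)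
  then show "card (simple_adj E `` {x}) \<le> d + 2 * card S + 3" by (simp add: degree_def)
qed

lemma card_encode: "card (nodes E) \<le> (card S + 2) * (d + 2 * card S + 4) * card (verts G)"
proof -
  have "card (nodes E) = (\<Sum>p\<in>core S G. card {..padding S ix b G p})"
    unfolding nodes_encode using finite_core by (intro card_SigmaI) auto
  also have "\<dots> \<le> (\<Sum>p\<in>core S G. d + 2 * card S + 4)"
  proof (rule sum_mono)
    fix p assume "p \<in> core S G"
    then have "snd p < card S + 2" by (auto simp: core_def)
    then show "card {..padding S ix b G p} \<le> d + 2 * card S + 4" by (simp add: padding_def b)
  qed
  also have "\<dots> = (card S + 2) * (d + 2 * card S + 4) * card (verts G)"
    by (simp add: core_def card_cartesian_product algebra_simps)
  finally show ?thesis .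
qed

lemma path_labels_encode:
  assumes "u \<in> verts G" "w \<in> verts G"
  shows "path_labels S ix b E ((u, 0), 0) ((w, 0), 0) = {s. info G (u, w) = Some s}"
proof (intro set_eqI iffI)
  have sub: "simple_adj E \<subseteq> nodes E \<times> nodes E" by (rule simple_adj_subset[OF simple_graph_encode])
  fix s assume "s \<in> path_labels S ix b E ((u, 0), 0) ((w, 0), 0)"
  then obtain a c where s: "s \<in> S" and adj: "(((u, 0), 0), a) \<in> simple_adj E" "(a, c) \<in> simple_adj E"
      "(c, ((w, 0), 0)) \<in> simple_adj E"
    and deg: "degree E a = b + ix s" "degree E c = b + 1"
    unfolding path_labels_def by blast
  have "a \<in> nodes E" "c \<in> nodes E" using adj sub by auto
  then obtain u' w' where a: "a = ((u', ix s), 0)" "u' \<in> verts G" and c: "c = ((w', 1), 0)" "w' \<in> verts G"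
    using deg degree_encode[of a "ix s"] degree_encode[of c 1] ix[OF s] by auto
  have cores: "(u, 0) \<in> core S G" "(u', ix s) \<in> core S G" "(w', 1) \<in> core S G"
    using assms(1) a(2) c(2) ix[OF s] by (simp_all add: core_def)
  have "(u', ix s) \<in> core_nbrs S ix G (u, 0)" using adj a adj_core_iff[OF cores(1)] by simp
  then have "u' = u" by (auto simp: core_nbrs_def core_arc_def ix_ne)
  have "(w, 0) \<in> core_nbrs S ix G (w', 1)" using adj c adj_core_iff[OF cores(3)] by simp
  then have "w' = w" by (auto simp: core_nbrs_def core_arc_def ix_ne)
  have "(w', 1) \<in> core_nbrs S ix G (u', ix s)" using adj a c adj_core_iff[OF cores(2)] by simp
  then have "\<exists>s'\<in>S. ix s = ix s' \<and> info G (u', w') = Some s'"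
    using s by (auto simp: core_nbrs_def core_arc_def ix_ne)
  then show "s \<in> {s. info G (u, w) = Some s}"
    using s inj_ix \<open>u' = u\<close> \<open>w' = w\<close> by (auto simp: inj_on_eq_iff)
next
  fix s assume "s \<in> {s. info G (u, w) = Some s}"
  then have s: "info G (u, w) = Some s" "s \<in> S" using info_in by auto
  have cores: "(u, 0) \<in> core S G" "(u, ix s) \<in> core S G" "(w, 1) \<in> core S G" "(w, 0) \<in> core S G"
    using assms ix[OF s(2)] by (simp_all add: core_def)
  have "(((u, 0), 0), ((u, ix s), 0)) \<in> simple_adj E"
    unfolding adj_core_iff[OF cores(1)] using cores s ix_ne(1)[of s] by (simp add: core_nbrs_def core_arc_def)
  moreover have "(((u, ix s), 0), ((w, 1), 0)) \<in> simple_adj E"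
    unfolding adj_core_iff[OF cores(2)] using cores s by (auto simp: core_nbrs_def core_arc_def)
  moreover have "(((w, 1), 0), ((w, 0), 0)) \<in> simple_adj E"
    unfolding adj_core_iff[OF cores(3)] using cores by (simp add: core_nbrs_def core_arc_def)
  moreover have "degree E ((u, ix s), 0) = b + ix s" "degree E ((w, 1), 0) = b + 1"
    using degree_core cores by simp_all
  ultimately show "s \<in> path_labels S ix b E ((u, 0), 0) ((w, 0), 0)"
    using s(2) unfolding path_labels_def by blast
qed

end

definition rename :: "('v \<Rightarrow> 'w) \<Rightarrow> 'v sgraph \<Rightarrow> 'w sgraph" where
  "rename j H = SGraph (j ` nodes H) ((`) j ` edges H)"

lemma rename_sel [simp]: "nodes (rename j H) = j ` nodes H" "edges (rename j H) = (`) j ` edges H"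
  by (simp_all add: rename_def)

lemma simple_adj_rename:
  assumes H: "simple_graph H" and j: "inj_on j (nodes H)" and x: "x \<in> nodes H"
  shows "simple_adj (rename j H) `` {j x} = j ` (simple_adj H `` {x})"
proof (intro set_eqI iffI)
  fix y assume "y \<in> simple_adj (rename j H) `` {j x}"
  then obtain e where e: "e \<in> edges H" "{j x, y} = j ` e"
    by (auto simp: simple_adj_def)
  then have eN: "e \<subseteq> nodes H" using H by (simp add: simple_graph_def)
  have "j x \<in> j ` e" using e(2) by blast
  then have "x \<in> e" using j eN x by (auto simp: inj_on_def)
  moreover obtain p q where "e = {p, q}" using e(1) H by (auto simp: simple_graph_def card_2_iff)
  ultimately obtain z where z: "e = {x, z}" by auto
  then have "y = j z" using e(2) by (auto simp: doubleton_eq_iff)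
  then show "y \<in> j ` (simple_adj H `` {x})" using z e(1) by (auto simp: simple_adj_def)
next
  fix y assume "y \<in> j ` (simple_adj H `` {x})"
  then obtain z where z: "y = j z" "{x, z} \<in> edges H" by (auto simp: simple_adj_def)
  then have "{j x, y} = j ` {x, z}" by simp
  then have "{j x, y} \<in> (`) j ` edges H" using z(2) by (rule image_eqI)
  then show "y \<in> simple_adj (rename j H) `` {j x}" by (simp add: simple_adj_def)
qed

lemma degree_rename:
  assumes "simple_graph H" "inj_on j (nodes H)" "x \<in> nodes H"
  shows "degree (rename j H) (j x) = degree H x"
  by (rule degree_transfer[OF assms(2) _ simple_adj_rename[OF assms]])
    (use simple_adj_subset[OF assms(1)] in auto)

lemma path_labels_rename:
  assumes "simple_graph H" "inj_on j (nodes H)" "x \<in> nodes H" "y \<in> nodes H"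
  shows "path_labels S ix b (rename j H) (j x) (j y) = path_labels S ix b H x y"
  by (rule path_labels_transfer[OF assms(2,4,3) _ _ _ simple_adj_rename[OF assms(1,2)]])
    (use simple_adj_subset[OF assms(1)] in auto)

lemma simple_graph_rename:
  assumes "simple_graph H" "inj_on j (nodes H)"
  shows "simple_graph (rename j H)"
  unfolding simple_graph_def
proof (intro conjI ballI)
  show "finite (nodes (rename j H))" using assms(1) by (simp add: simple_graph_def)
  fix e assume "e \<in> edges (rename j H)"
  then obtain e' where e': "e = j ` e'" "e' \<in> edges H" by auto
  then have "e' \<subseteq> nodes H" "card e' = 2" using assms(1) by (auto simp: simple_graph_def)
  then show "e \<subseteq> nodes (rename j H)" "card e = 2"
    using e' card_image[OF inj_on_subset[OF assms(2)]] by auto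
qed

lemma finite_inj_into_infinite:
  assumes "finite X" "infinite Y"
  shows "\<exists>h. inj_on h X \<and> h ` X \<subseteq> Y"
proof -
  obtain Y' where Y': "Y' \<subseteq> Y" "finite Y'" "card Y' = card X"
    using infinite_arbitrarily_large[OF assms(2)] by metis
  then obtain h where "bij_betw h X Y'" using finite_same_card_bij[OF assms(1)] by metis
  then show ?thesis using Y'(1) unfolding bij_betw_def by auto
qed

text \<open>
  The encoding is moved to the given infinite universe by an injection which sends the centre
  of the cluster of \<open>u\<close> to \<open>u\<close> itself.  In this way decoding returns exactly \<open>G\<close>, and not merely
  an isomorphic copy.
\<close>

lemma exists_encoding:
  fixes G :: "('v::infinite, 's) igraph"
  assumes "encoding S ix d b G"
  shows "\<exists>H :: 'v sgraph. simple_graph H \<and> simple_bounded (d + 2 * card S + 3) H \<and>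
    card (nodes H) \<le> (card S + 2) * (d + 2 * card S + 4) * card (verts G) \<and> decode S ix b d H = G"
proof -
  interpret encoding S ix d b G by fact
  let ?C = "(\<lambda>u. ((u, 0 :: nat), 0 :: nat)) ` verts G"
  have finE: "finite (nodes E)" using simple_graph_encode by (simp add: simple_graph_def)
  have CE: "?C \<subseteq> nodes E" by (auto simp: nodes_encode core_def)
  have "infinite (- verts G)"
    using finite_verts infinite_UNIV by (metis finite_compl)
  then obtain h where h: "inj_on h (nodes E - ?C)" "h ` (nodes E - ?C) \<subseteq> - verts G"
    using finite_inj_into_infinite[of "nodes E - ?C"] finE by blast
  \<comment> \<open>Centres go to the vertices that they stand for, all other nodes outside of \<open>verts G\<close>.\<close>
  define j where "j x = (if x \<in> ?C then fst (fst x) else h x)" for x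
  have jC: "j ((u, 0), 0) = u" if "u \<in> verts G" for u using that by (simp add: j_def)
  have jE: "j x \<notin> verts G" if "x \<in> nodes E - ?C" for x using h(2) that by (auto simp: j_def)
  have inj: "inj_on j (nodes E)"
  proof (rule inj_onI)
    fix x y assume xy: "x \<in> nodes E" "y \<in> nodes E" "j x = j y"
    show "x = y"
    proof (cases "x \<in> ?C")
      case True
      then have "j x \<in> verts G" using jC by auto
      then have "y \<in> ?C" using jE[of y] xy(2,3) by (metis DiffI)
      then show ?thesis using True xy(3) jC by auto
    next
      case False
      then have "j y \<notin> verts G" using jE[of x] xy(1,3) by (metis DiffI)
      then have "y \<notin> ?C" using jC by auto
      then show ?thesis using False xy h(1) by (simp add: j_def inj_on_eq_iff)
    qed
  qed
  define H where "H = rename j E"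
  have nodesH: "nodes H = j ` nodes E" by (simp add: H_def)
  have H: "simple_graph H" unfolding H_def using simple_graph_encode inj by (rule simple_graph_rename)
  have deg: "degree H (j x) = degree E x" if "x \<in> nodes E" for x
    unfolding H_def using degree_rename[OF simple_graph_encode inj that] .
  have "simple_bounded (d + 2 * card S + 3) H"
    using simple_bounded_encode deg unfolding simple_bounded_iff[OF H] simple_bounded_iff[OF simple_graph_encode]
      nodesH degree_def by auto
  moreover have "card (nodes H) = card (nodes E)" unfolding nodesH using inj by (rule card_image)
  moreover have "decode S ix b d H = G"
  proof -
    have C: "{x \<in> nodes E. degree E x = b} = ?C" using degree_encode[of _ 0] CE by auto
    have "{x \<in> nodes H. degree H x = b} = j ` {x \<in> nodes E. degree H (j x) = b}"
      unfolding nodesH by blast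
    also have "{x \<in> nodes E. degree H (j x) = b} = ?C"
      unfolding C[symmetric] by (intro Collect_cong conj_cong refl) (simp add: deg)
    also have "j ` ?C = (\<lambda>u. j ((u, 0), 0)) ` verts G" by (rule image_image)
    also have "\<dots> = (\<lambda>u. u) ` verts G" by (rule image_cong) (simp_all add: jC)
    also have "\<dots> = verts G" by simp
    finally have V: "{x \<in> nodes H. degree H x = b} = verts G" .
    have "info (decode_raw S ix b H) (u, w) = info G (u, w)" for u w
    proof (cases "u \<in> verts G \<and> w \<in> verts G")
      case True
      then have "path_labels S ix b H u w = path_labels S ix b H (j ((u, 0), 0)) (j ((w, 0), 0))"
        by (simp add: jC)
      also have "\<dots> = path_labels S ix b E ((u, 0), 0) ((w, 0), 0)"
        unfolding H_def using True CE by (intro path_labels_rename[OF simple_graph_encode inj]) auto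
      also have "\<dots> = {s. info G (u, w) = Some s}" using True by (simp add: path_labels_encode)
      finally have "path_labels S ix b H u w = {s. info G (u, w) = Some s}" .
      moreover have "u \<in> {x \<in> nodes H. degree H x = b}" "w \<in> {x \<in> nodes H. degree H x = b}"
        using True V by simp_all
      ultimately show ?thesis
        by (cases "info G (u, w)") (simp_all add: decode_raw_def is_singleton_def)
    next
      case False
      then have "info G (u, w) = None" using info_in by (cases "info G (u, w)") auto
      moreover have "\<not> (u \<in> {x \<in> nodes H. degree H x = b} \<and> w \<in> {x \<in> nodes H. degree H x = b})"
        using False V by simp
      ultimately show ?thesis by (auto simp: decode_raw_def)
    qed
    then have "decode_raw S ix b H = G" using V by (intro igraph.expand) auto
    then show ?thesis using G by (simp add: decode_def cap_degree_id)
  qed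
  ultimately show ?thesis using H card_encode by auto
qed


section \<open>Programs for arithmetic\<close>

definition add_prog :: prog where
  "add_prog = PrimRec (Proj 0) (Comp Succ [Proj 1])"

definition mult_prog :: prog where
  "mult_prog = PrimRec Zero (Comp add_prog [Proj 1, Proj 2])"

primrec const_prog :: "nat \<Rightarrow> prog" where
  "const_prog 0 = Zero"
| "const_prog (Suc n) = Comp Succ [const_prog n]"

lemma computes_Proj: "i < length xs \<Longrightarrow> xs ! i = y \<Longrightarrow> computes orac (Proj i) xs y"
  using computes.proj by metis

lemma computes_add_prog: "computes orac add_prog [x, y] (x + y)"
proof (induction x)
  case 0
  show ?case unfolding add_prog_def by (rule computes.primrec_0) (rule computes_Proj; simp)
next
  case (Suc x)
  have "computes orac (Comp Succ [Proj 1]) [x, x + y, y] (Suc (x + y))"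
    by (rule computes.comp[where ys = "[x + y]"]) (auto intro: computes_Proj computes.succ)
  then show ?case using Suc unfolding add_prog_def by (auto intro: computes.primrec_Suc)
qed

lemma computes_mult_prog: "computes orac mult_prog [x, y] (x * y)"
proof (induction x)
  case 0
  show ?case unfolding mult_prog_def by (auto intro: computes.primrec_0 computes.zero)
next
  case (Suc x)
  have "computes orac (Comp add_prog [Proj 1, Proj 2]) [x, x * y, y] (x * y + y)"
    by (rule computes.comp[where ys = "[x * y, y]"]) (auto intro: computes_Proj computes_add_prog)
  then show ?case using Suc unfolding mult_prog_def by (auto intro: computes.primrec_Suc simp: add.commute)
qed

lemma computes_const_prog: "computes orac (const_prog n) xs n"
proof (induction n)
  case (Suc n)
  then show ?case by (auto intro: computes.comp[where ys = "[n]"] computes.succ)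
qed (simp add: computes.zero)

lemma computes_add:
  "computes orac f xs x \<Longrightarrow> computes orac g xs y \<Longrightarrow> computes orac (Comp add_prog [f, g]) xs (x + y)"
  by (rule computes.comp[where ys = "[x, y]"]) (simp_all add: computes_add_prog)

lemma computes_mult:
  "computes orac f xs x \<Longrightarrow> computes orac g xs y \<Longrightarrow> computes orac (Comp mult_prog [f, g]) xs (x * y)"
  by (rule computes.comp[where ys = "[x, y]"]) (simp_all add: computes_mult_prog)


section \<open>The two reductions\<close>

lemma SG_reducible_Ext:
  fixes S :: "'s set" and A :: "nat \<Rightarrow> ('v, 's) igraph set"
  assumes S: "finite S"
    and A: "\<And>d k. d \<ge> 2 \<Longrightarrow> k \<ge> 1 \<Longrightarrow> natural_extension S d k (A d)"
  shows "reducible (SG TYPE('v)) (Ext S A)"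
proof -
  have "f \<in> SG TYPE('v)" if f: "f \<in> Ext S A" for f
    unfolding SG_def
  proof (intro CollectI allI impI conjI)
    fix d k \<epsilon> assume dom: "in_domain d k \<epsilon>"
    show "f d k \<epsilon> > 0" using f dom unfolding Ext_def by blast
    fix G :: "'v sgraph" assume G: "simple_graph G \<and> simple_bounded d G \<and> nodes G \<noteq> {}"
    have nat: "natural_extension S d k (A d)" using dom by (intro A) (auto simp: in_domain_def)
    then obtain GS where GS: "GS \<in> A d" "underlying GS = G"
      using G unfolding natural_extension_def by blast
    then have neG: "verts GS \<noteq> {}" using G by auto
    then obtain HS where HS: "HS \<in> A d" "verts HS \<noteq> {}" "info_freq_dist S d k GS HS \<le> of_rat \<epsilon>"
        "card (verts HS) \<le> f d k \<epsilon>"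
      using f dom GS(1) unfolding Ext_def by blast
    have sub: "K \<in> Omega S" "info_bounded d K" if "K \<in> A d" for K
      using nat that unfolding natural_extension_def natural_def by blast+
    have "simple_freq_dist d k G (underlying HS) \<le> of_rat \<epsilon>"
      using underlying_freq_dist_le[OF S sub[OF GS(1)] neG sub[OF HS(1)] HS(2), of k] HS(3) GS(2) by simp
    then show "\<exists>H :: 'v sgraph. simple_graph H \<and> simple_bounded d H \<and> nodes H \<noteq> {} \<and>
        simple_freq_dist d k G H \<le> of_rat \<epsilon> \<and> card (nodes H) \<le> f d k \<epsilon>"
      using HS sub[OF HS(1)] simple_graph_underlying simple_bounded_underlying
      by (intro exI[of _ "underlying HS"]) auto
  qed
  then show ?thesis
    unfolding reducible_def
    by (intro exI[of _ Query]) (auto intro!: computes.query simp: oracle_of_def)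
qed

lemma SG_approximation:
  fixes G :: "'v sgraph"
  assumes "f \<in> SG TYPE('v)" "in_domain d k \<epsilon>" "simple_graph G" "simple_bounded d G" "nodes G \<noteq> {}"
  shows "\<exists>H :: 'v sgraph. simple_graph H \<and> simple_bounded d H \<and> nodes H \<noteq> {} \<and>
    simple_freq_dist d k G H \<le> of_rat \<epsilon> \<and> card (nodes H) \<le> f d k \<epsilon>"
  using assms unfolding SG_def by blast

text \<open>
  The proportion of centres in \<open>E\<close> is at least \<open>1 / C\<close>.  In \<open>H\<close> it differs by at most
  \<open>\<epsilon> / (2 * C)\<close> from that, hence is positive and the decoded graph is non-empty; and the two
  error terms of \<open>decode_freq_dist\<close> add up to at most \<open>\<epsilon> / C\<close>, which is at most \<open>\<epsilon>\<close> times
  the proportion.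
\<close>

lemma approximation_by_decoding:
  fixes S :: "'s set" and G :: "('v::infinite, 's) igraph" and \<epsilon> :: real
  assumes S: "finite S" and G: "G \<in> Omega S" "info_bounded d G" "verts G \<noteq> {}" and \<epsilon>: "0 < \<epsilon>" "\<epsilon> < 1"
  defines "C \<equiv> (card S + 2) * (d + 2 * card S + 4)"
  assumes approx: "\<And>E :: 'v sgraph. simple_graph E \<Longrightarrow> simple_bounded (d + 2 * card S + 3) E \<Longrightarrow> nodes E \<noteq> {} \<Longrightarrow>
    \<exists>H :: 'v sgraph. simple_graph H \<and> simple_bounded (d + 2 * card S + 3) H \<and> nodes H \<noteq> {} \<and>
      simple_freq_dist (d + 2 * card S + 3) (3 * k + 10) E H \<le> \<epsilon> / (2 * real C) \<and> card (nodes H) \<le> N"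
  shows "\<exists>F. F \<in> Omega S \<and> info_bounded d F \<and> verts F \<noteq> {} \<and> info_freq_dist S d k G F \<le> \<epsilon> \<and>
    card (verts F) \<le> N"
proof -
  let ?d = "d + 2 * card S + 3" and ?k = "3 * k + 10" and ?b = "d + card S + 2"
  obtain h where h: "bij_betw h S {0..<card S}" using ex_bij_betw_finite_nat[OF S] by blast
  define ix where "ix s = h s + 2" for s
  have "encoding S ix d ?b G"
  proof
    show "inj_on ix S" using h by (auto simp: ix_def bij_betw_def inj_on_def)
    show "2 \<le> ix s \<and> ix s < card S + 2" if "s \<in> S" for s
      using bij_betw_apply[OF h that] by (simp add: ix_def)
  qed (use S G in auto)
  then obtain E :: "'v sgraph" where E: "simple_graph E" "simple_bounded ?d E"
      "card (nodes E) \<le> C * card (verts G)" "decode S ix ?b d E = G"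
    using exists_encoding unfolding C_def by blast
  have VE: "verts G \<subseteq> nodes E" using E(4) verts_decode[of S ix ?b d E] by auto
  then have neE: "nodes E \<noteq> {}" using G(3) by auto
  then obtain H :: "'v sgraph" where H: "simple_graph H" "simple_bounded ?d H" "nodes H \<noteq> {}"
      "simple_freq_dist ?d ?k E H \<le> \<epsilon> / (2 * real C)" "card (nodes H) \<le> N"
    using approx[OF E(1,2)] by blast
  define F where "F = decode S ix ?b d H"
  let ?\<mu>E = "real (card (verts G)) / real (card (nodes E))"
  let ?\<mu>H = "real (card (verts F)) / real (card (nodes H))"
  let ?\<delta> = "\<epsilon> / (2 * real C)"
  have "C > 0" by (simp add: C_def)
  then have C: "real C > 0" by simp
  have "real (card (nodes E)) \<le> real C * real (card (verts G))"
    using E(3) by (metis of_nat_le_iff of_nat_mult)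
  moreover have "card (nodes E) > 0" using E(1) neE by (simp add: simple_graph_def card_gt_0_iff)
  ultimately have \<mu>E: "1 / real C \<le> ?\<mu>E" using C by (simp add: field_simps)
  have \<mu>: "\<bar>?\<mu>E - ?\<mu>H\<bar> \<le> ?\<delta>"
    using decode_freq_dist(1)[OF S E(1,2) H(1,2), of ix ?b d k] H(4) unfolding E(4) F_def by linarith
  have "?\<delta> < 1 / real C" using C \<epsilon> by (simp add: field_simps)
  then have "?\<mu>H > 0" using \<mu> \<mu>E by linarith
  then have neF: "verts F \<noteq> {}" by auto
  have "info_freq_dist S d k G F * ?\<mu>E \<le> simple_freq_dist ?d ?k E H + \<bar>?\<mu>E - ?\<mu>H\<bar>"
    using decode_freq_dist(2)[OF S E(1,2) H(1,2), of ix ?b d k] G(3) neF unfolding E(4) F_def by blast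
  also have "\<dots> \<le> ?\<delta> + ?\<delta>" using H(4) \<mu> by linarith
  also have "\<dots> = \<epsilon> * (1 / real C)" by simp
  also have "\<dots> \<le> \<epsilon> * ?\<mu>E" using \<mu>E \<epsilon> by (intro mult_left_mono) auto
  finally have "info_freq_dist S d k G F * ?\<mu>E \<le> \<epsilon> * ?\<mu>E" .
  moreover have "0 < 1 / real C" using C by simp
  then have "?\<mu>E > 0" using \<mu>E by linarith
  ultimately have "info_freq_dist S d k G F \<le> \<epsilon>" by (rule mult_right_le_imp_le)
  moreover have "card (verts F) \<le> card (nodes H)"
    unfolding F_def verts_decode using H(1) by (intro card_mono) (auto simp: simple_graph_def)
  ultimately show ?thesis
    using neF H(1,5) decode_Omega info_bounded_decode unfolding F_def by (metis order_trans)
qed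

lemma Ext_reducible_SG:
  fixes S :: "'s set" and A :: "nat \<Rightarrow> ('v::infinite, 's) igraph set"
  assumes S: "finite S"
    and A: "\<And>d k. d \<ge> 2 \<Longrightarrow> k \<ge> 1 \<Longrightarrow> natural S d k (A d)"
  shows "reducible (Ext S A) (SG TYPE('v))"
proof -
  let ?C = "\<lambda>d. (card S + 2) * (d + 2 * card S + 4)"
  \<comment> \<open>The degree bound of encodings, the radius that decoding needs, and the smaller error.\<close>
  define tr where "tr f d k \<epsilon> = f (d + 2 * card S + 3) (3 * k + 10) (\<epsilon> / of_nat (2 * ?C d))"
    for f :: "nat \<Rightarrow> nat \<Rightarrow> rat \<Rightarrow> nat" and d k \<epsilon>
  have dom': "in_domain (d + 2 * card S + 3) (3 * k + 10) (\<epsilon> / of_nat (2 * ?C d))"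
    if "in_domain d k \<epsilon>" for d k \<epsilon>
  proof -
    have "(1 :: rat) \<le> of_nat (2 * ?C d)" by (simp del: of_nat_mult of_nat_add)
    moreover have "0 < \<epsilon>" "\<epsilon> < 1" using that by (auto simp: in_domain_def)
    ultimately have "\<epsilon> < of_nat (2 * ?C d)" "(0 :: rat) < of_nat (2 * ?C d)" by linarith+
    then show ?thesis using \<open>0 < \<epsilon>\<close> unfolding in_domain_def by (simp del: of_nat_mult of_nat_add)
  qed
  have solution: "tr f \<in> Ext S A" if f: "f \<in> SG TYPE('v)" for f
    unfolding Ext_def
  proof (intro CollectI allI impI conjI ballI)
    fix d k \<epsilon> assume dom: "in_domain d k \<epsilon>"
    show "tr f d k \<epsilon> > 0" using f dom'[OF dom] unfolding SG_def tr_def by blast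
    fix G assume G: "G \<in> A d" "verts G \<noteq> {}"
    have nat: "natural S d k (A d)" using dom by (intro A) (auto simp: in_domain_def)
    then have GO: "G \<in> Omega S" "info_bounded d G" using G unfolding natural_def by blast+
    have \<epsilon>: "0 < real_of_rat \<epsilon>" "real_of_rat \<epsilon> < 1" using dom by (auto simp: in_domain_def)
    have eq: "real_of_rat (\<epsilon> / of_nat (2 * ?C d)) = real_of_rat \<epsilon> / (2 * real (?C d))"
      by (simp add: of_rat_divide of_rat_mult of_rat_add)
    have "\<exists>H :: 'v sgraph. simple_graph H \<and> simple_bounded (d + 2 * card S + 3) H \<and> nodes H \<noteq> {} \<and>
        simple_freq_dist (d + 2 * card S + 3) (3 * k + 10) E H \<le> real_of_rat \<epsilon> / (2 * real (?C d)) \<and>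
        card (nodes H) \<le> tr f d k \<epsilon>"
      if "simple_graph E" "simple_bounded (d + 2 * card S + 3) E" "nodes E \<noteq> {}" for E :: "'v sgraph"
      using SG_approximation[OF f dom'[OF dom] that] unfolding tr_def eq .
    then obtain F :: "('v, 's) igraph" where F: "F \<in> Omega S" "info_bounded d F" "verts F \<noteq> {}"
        "info_freq_dist S d k G F \<le> real_of_rat \<epsilon>" "card (verts F) \<le> tr f d k \<epsilon>"
      using approximation_by_decoding[OF S GO G(2) \<epsilon>] by blast
    then obtain H where "H \<in> A d" "verts H \<noteq> {}" "info_freq_dist S d k G H \<le> info_freq_dist S d k G F"
        "card (verts H) \<le> card (verts F)"
      using nat G unfolding natural_def by blast
    then show "\<exists>H\<in>A d. verts H \<noteq> {} \<and> info_freq_dist S d k G H \<le> real_of_rat \<epsilon> \<and> card (verts H) \<le> tr f d k \<epsilon>"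
      using F by (intro bexI[of _ H]) auto
  qed
  define alg where "alg = Comp Query
    [Comp add_prog [Proj 0, const_prog (2 * card S + 3)],
     Comp add_prog [Comp mult_prog [const_prog 3, Proj 1], const_prog 10],
     Proj 2,
     Comp mult_prog [Proj 3, Comp mult_prog [const_prog (2 * (card S + 2)),
       Comp add_prog [Proj 0, const_prog (2 * card S + 4)]]]]"
  have "computes (oracle_of f) alg [d, k, p, q] (tr f d k (fraction p q))"
    if "q > 0" "in_domain d k (fraction p q)" for f d k p q
  proof -
    let ?q = "q * (2 * (card S + 2) * (d + (2 * card S + 4)))"
    have eq: "fraction p ?q = fraction p q / of_nat (2 * ?C d)"
      by (simp add: fraction_def mult.assoc add.assoc)
    have "oracle_of f [d + (2 * card S + 3), 3 * k + 10, p, ?q] = Some (tr f d k (fraction p q))"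
      using dom'[OF that(2)] that(1) unfolding oracle_of_def tr_def eq[symmetric] by (simp add: add.assoc)
    then show ?thesis
      unfolding alg_def
      by (intro computes.comp[where ys = "[d + (2 * card S + 3), 3 * k + 10, p, ?q]"] computes.query
          list.rel_intros computes_add computes_mult computes_const_prog computes_Proj) simp_all
  qed
  then show ?thesis unfolding reducible_def using solution by blast
qed

theorem theorem2p3:
  fixes S :: "'s set"
    and A :: "nat \<Rightarrow> ('v::infinite, 's) igraph set"
  assumes "finite S" and "S \<noteq> {}"
    and "\<And>d k. d \<ge> 2 \<Longrightarrow> k \<ge> 1 \<Longrightarrow> natural_extension S d k (A d)"
  shows "interreducible (SG TYPE('v)) (Ext S A)"
proof -
  have "natural S d k (A d)" if "d \<ge> 2" "k \<ge> 1" for d k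
    using assms(3)[OF that] unfolding natural_extension_def by blast
  then show ?thesis
    unfolding interreducible_def
    using SG_reducible_Ext[OF assms(1,3)] Ext_reducible_SG[OF assms(1)] by blast
qed

end
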